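(* There exist functions $\sigma_+,\sigma_-:(0,1)\to(0,1/2)$ such that for every $q\in(0,1)$ there are constants $c,C\in(0,\infty)$ (depending on $q$) such that for every integer $n\ge 1$, $$c\,n^{-\sigma_-(q)}<\sup_{u\in\mathcal{U}_q}P(S_n^u=0)<C\,n^{-\sigma_+(q)},$$ and moreover $$\sigma_-(q)\to 0\quad\text{as } q\nearrow 1.$$
   Context: Controlled simple random walk: fix $q\in[0,1)$. The process $\{S_i^u\}_{i\ge 0}$ is integer valued with $S_0^u=0$, and $\mathcal{F}_i=\sigma(S_0^u,\dots,S_i^u)$ is the sigma-field generated by the process up to time $i$. A $q$-admissible control is a collection of random variables $u=\{u_i\}_{i\ge 0}$ such that $u_i\in[0,q]$ almost surely and $u_i$ is $\mathcal{F}_i$-measurable (adapted) for every $i$. $\mathcal{U}_q$ denotes the set of all $q$-admissible controls. For $u\in\mathcal{U}_q$, the controlled walk is determined by $$P(S_{i+1}^u=S_i^u+\Delta\mid\mathcal{F}_i)=\begin{cases}u_i,&\Delta=0,\\ (1-u_i)/2,&\Delta=\pm1.\end{cases}$$ *)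

theory Defs
  imports "HOL-Probability.Probability"
begin

definition past :: "'a measure \<Rightarrow> (nat \<Rightarrow> 'a \<Rightarrow> int) \<Rightarrow> nat \<Rightarrow> 'a measure" where
  "past M S i = sigma (space M) {S j -` B \<inter> space M | j B. j \<le> i}"

definition admissible_control ::
  "real \<Rightarrow> 'a measure \<Rightarrow> (nat \<Rightarrow> 'a \<Rightarrow> int) \<Rightarrow> (nat \<Rightarrow> 'a \<Rightarrow> real) \<Rightarrow> bool" where
  "admissible_control q M S u \<longleftrightarrow>
     (\<forall>i. u i \<in> borel_measurable (past M S i)) \<and>
     (\<forall>i. AE \<omega> in M. u i \<omega> \<in> {0..q})"

definition controlled_walk ::
  "real \<Rightarrow> 'a measure \<Rightarrow> (nat \<Rightarrow> 'a \<Rightarrow> int) \<Rightarrow> (nat \<Rightarrow> 'a \<Rightarrow> real) \<Rightarrow> bool" where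
  "controlled_walk q M S u \<longleftrightarrow>
     prob_space M \<and>
     (\<forall>i. S i \<in> M \<rightarrow>\<^sub>M count_space UNIV) \<and>
     (AE \<omega> in M. S 0 \<omega> = 0) \<and>
     admissible_control q M S u \<and>
     (\<forall>i. AE \<omega> in M.
        real_cond_exp M (past M S i) (indicator {\<omega>. S (Suc i) \<omega> = S i \<omega>}) \<omega> = u i \<omega>) \<and>
     (\<forall>i. \<forall>\<Delta>\<in>{-1, 1}. AE \<omega> in M.
        real_cond_exp M (past M S i) (indicator {\<omega>. S (Suc i) \<omega> = S i \<omega> + \<Delta>}) \<omega>
          = (1 - u i \<omega>) / 2)"

text \<open>
  The control and the walk are built together, so the supremum over admissible controls ranges
  over all triples of a probability space, a walk on it and a control adapted to that walk.
  HOL cannot quantify over the underlying type inside the supremum; it is fixed to integer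
  sequences, with an arbitrary measure and sigma-algebra on them.  The lemma
  \<open>controlled_walk_canonical\<close> below shows that this loses nothing: a controlled walk on any
  probability space has the law of one on sequence space.
\<close>

definition return_probs :: "real \<Rightarrow> nat \<Rightarrow> real set" where
  "return_probs q n =
     {measure M {\<omega> \<in> space M. S n \<omega> = 0} |
        (M :: (nat \<Rightarrow> int) measure) S u. controlled_walk q M S u}"

definition sup_return_prob :: "real \<Rightarrow> nat \<Rightarrow> real" where
  "sup_return_prob q n = Sup (return_probs q n)"

lemma space_past [simp]: "space (past M S i) = space M"
  unfolding past_def by (rule space_measure_of) auto

lemma sets_past: "sets (past M S i) = sigma_sets (space M) {S j -` B \<inter> space M | j B. j \<le> i}"
  unfolding past_def by (rule sets_measure_of) auto

lemma subalgebra_past: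
  assumes "\<And>i. S i \<in> M \<rightarrow>\<^sub>M count_space UNIV"
  shows "subalgebra M (past M S i)"
  unfolding subalgebra_def sets_past
  by (auto intro!: sets.sigma_sets_subset measurable_sets[OF assms])

lemma past_pullback:
  fixes N :: "(nat \<Rightarrow> int) measure"
  assumes sp: "space N = UNIV"
  shows "sets (past M S i) = {(\<lambda>\<omega> k. S k \<omega>) -` B \<inter> space M | B. B \<in> sets (past N (\<lambda>k x. x k) i)}"
proof -
  let ?X = "\<lambda>\<omega> k. S k \<omega>"
  let ?G = "{(\<lambda>x. x j) -` B \<inter> space N | j B. j \<le> i} :: (nat \<Rightarrow> int) set set"
  have "{?X -` B \<inter> space M | B. B \<in> sigma_sets UNIV ?G}
      = sigma_sets (space M) {?X -` B \<inter> space M | B. B \<in> ?G}"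
    by (rule sigma_sets_vimage_commute) auto
  also have "{?X -` B \<inter> space M | B. B \<in> ?G} = {S j -` B \<inter> space M | j B. j \<le> i}"
  proof (intro equalityI subsetI)
    fix A assume "A \<in> {?X -` B \<inter> space M | B. B \<in> ?G}"
    then obtain j B where "j \<le> i" "A = ?X -` ((\<lambda>x. x j) -` B \<inter> space N) \<inter> space M" by blast
    then have "A = S j -` B \<inter> space M \<and> j \<le> i" by (auto simp: sp)
    then show "A \<in> {S j -` B \<inter> space M | j B. j \<le> i}" by blast
  next
    fix A assume "A \<in> {S j -` B \<inter> space M | j B. j \<le> i}"
    then obtain j B where j: "j \<le> i" "A = S j -` B \<inter> space M" by blast
    then have "A = ?X -` ((\<lambda>x. x j) -` B \<inter> space N) \<inter> space M" by (auto simp: sp)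
    then show "A \<in> {?X -` B \<inter> space M | B. B \<in> ?G}" using j(1) by blast
  qed
  finally show ?thesis unfolding sets_past sp by simp
qed

lemma cond_exp_pullback:
  fixes N :: "(nat \<Rightarrow> int) measure"
  assumes "prob_space M"
    and S: "\<And>i. S i \<in> M \<rightarrow>\<^sub>M count_space UNIV"
    and N: "N = distr M (PiM UNIV (\<lambda>_. count_space UNIV)) (\<lambda>\<omega> k. S k \<omega>)"
    and f: "integrable N f"
  shows "AE \<omega> in M. real_cond_exp M (past M S i) (\<lambda>\<omega>. f (\<lambda>k. S k \<omega>)) \<omega>
           = real_cond_exp N (past N (\<lambda>k x. x k) i) f (\<lambda>k. S k \<omega>)"
proof -
  let ?P = "PiM (UNIV :: nat set) (\<lambda>_. count_space (UNIV :: int set))"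
  let ?X = "\<lambda>\<omega> k. S k \<omega>"
  let ?F = "past N (\<lambda>k x. x k) i"
  interpret M: prob_space M by fact
  have X [measurable]: "?X \<in> M \<rightarrow>\<^sub>M ?P"
    by (rule measurable_PiM_single') (auto intro: S)
  interpret N: prob_space N unfolding N by (rule M.prob_space_distr[OF X])
  have spN: "space N = UNIV" by (simp add: N space_PiM)
  have setsN: "sets N = sets ?P" by (simp add: N)
  have co: "(\<lambda>x. x k) \<in> N \<rightarrow>\<^sub>M count_space UNIV" for k
    unfolding measurable_cong_sets[OF setsN refl] by measurable
  have subN: "subalgebra N ?F" by (rule subalgebra_past) (rule co)
  have subM: "subalgebra M (past M S i)" by (rule subalgebra_past) (rule S)
  interpret CN: finite_measure_subalgebra N ?F by unfold_locales (rule subN)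
  interpret CM: finite_measure_subalgebra M "past M S i" by unfold_locales (rule subM)
  have bF: "real_cond_exp N ?F f \<in> borel_measurable ?F" by simp
  have int: "integrable N (real_cond_exp N ?F f)" by (rule CN.real_cond_exp_int(1)[OF f])
  have tr: "integrable M (\<lambda>\<omega>. g (?X \<omega>))" if "integrable N g" for g :: "(nat \<Rightarrow> int) \<Rightarrow> real"
    using that integrable_distr[OF X] unfolding N by blast
  have ti: "(\<integral>\<omega>. g (?X \<omega>) \<partial>M) = (\<integral>x. g x \<partial>N)" if "integrable N g" for g :: "(nat \<Rightarrow> int) \<Rightarrow> real"
    using that unfolding N by (subst integral_distr[OF X]) auto
  show ?thesis
  proof (rule CM.real_cond_exp_charact)
    fix A assume "A \<in> sets (past M S i)"
    then have "A \<in> {?X -` B \<inter> space M | B. B \<in> sets ?F}"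
      by (simp only: past_pullback[OF spN, of M S i])
    then obtain B where B: "B \<in> sets ?F" "A = ?X -` B \<inter> space M" by blast
    have BN: "B \<in> sets N" using B(1) subN by (auto simp: subalgebra_def)
    have set: "(\<integral>\<omega>\<in>A. g (?X \<omega>) \<partial>M) = (\<integral>x\<in>B. g x \<partial>N)"
      if "integrable N g" for g :: "(nat \<Rightarrow> int) \<Rightarrow> real"
    proof -
      have "(\<integral>\<omega>\<in>A. g (?X \<omega>) \<partial>M) = (\<integral>\<omega>. indicator B (?X \<omega>) *\<^sub>R g (?X \<omega>) \<partial>M)"
        unfolding set_lebesgue_integral_def
        by (rule Bochner_Integration.integral_cong) (auto simp: B(2) indicator_def)
      also have "\<dots> = (\<integral>x\<in>B. g x \<partial>N)"
        unfolding set_lebesgue_integral_def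
        by (rule ti) (rule integrable_mult_indicator[OF BN that])
      finally show ?thesis .
    qed
    show "(\<integral>\<omega>\<in>A. f (?X \<omega>) \<partial>M) = (\<integral>\<omega>\<in>A. real_cond_exp N ?F f (?X \<omega>) \<partial>M)"
      unfolding set[OF f] set[OF int] by (rule CN.real_cond_exp_intA[OF f B(1)])
  next
    show "integrable M (\<lambda>\<omega>. f (?X \<omega>))" by (rule tr[OF f])
    show "integrable M (\<lambda>\<omega>. real_cond_exp N ?F f (?X \<omega>))" by (rule tr[OF int])
    have "?X \<in> past M S i \<rightarrow>\<^sub>M ?F"
    proof (rule measurableI)
      show "?X \<omega> \<in> space ?F" for \<omega> by (simp add: spN)
      show "?X -` B \<inter> space (past M S i) \<in> sets (past M S i)" if "B \<in> sets ?F" for B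
      proof -
        have "?X -` B \<inter> space M \<in> {?X -` B \<inter> space M | B. B \<in> sets ?F}" using that by blast
        then show ?thesis by (simp only: past_pullback[OF spN, of M S i] space_past)
      qed
    qed
    from measurable_compose[OF this bF]
    show "(\<lambda>\<omega>. real_cond_exp N ?F f (?X \<omega>)) \<in> borel_measurable (past M S i)" .
  qed
qed

lemma controlled_walk_canonical:
  assumes walk: "controlled_walk q M S u"
  defines "N \<equiv> distr M (PiM UNIV (\<lambda>_. count_space UNIV)) (\<lambda>\<omega> k. S k \<omega>)"
  shows "\<exists>v. controlled_walk q N (\<lambda>k x. x k) v"
    and "measure N {x \<in> space N. x n = 0} = measure M {\<omega> \<in> space M. S n \<omega> = 0}"
    and "measure M {\<omega> \<in> space M. S n \<omega> = 0} \<in> return_probs q n"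
proof -
  let ?P = "PiM (UNIV :: nat set) (\<lambda>_. count_space (UNIV :: int set))"
  let ?X = "\<lambda>\<omega> k. S k \<omega>"
  let ?Y = "\<lambda>k x. x k :: int"
  have M: "prob_space M" and S: "\<And>i. S i \<in> M \<rightarrow>\<^sub>M count_space UNIV"
    and S0: "AE \<omega> in M. S 0 \<omega> = 0"
    and uq: "\<And>i. AE \<omega> in M. u i \<omega> \<in> {0..q}"
    and stay: "\<And>i. AE \<omega> in M. real_cond_exp M (past M S i)
                 (indicator {\<omega>. S (Suc i) \<omega> = S i \<omega>}) \<omega> = u i \<omega>"
    and move: "\<And>i d. d \<in> {-1, 1} \<Longrightarrow> AE \<omega> in M. real_cond_exp M (past M S i)
                 (indicator {\<omega>. S (Suc i) \<omega> = S i \<omega> + d}) \<omega> = (1 - u i \<omega>) / 2"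
    using walk unfolding controlled_walk_def admissible_control_def by blast+
  interpret M: prob_space M by fact
  have X [measurable]: "?X \<in> M \<rightarrow>\<^sub>M ?P"
    by (rule measurable_PiM_single') (auto intro: S)
  interpret N: prob_space N unfolding N_def by (rule M.prob_space_distr[OF X])
  have spN: "space N = UNIV" by (simp add: N_def space_PiM)
  have setsN: "sets N = sets ?P" by (simp add: N_def)
  have co [measurable]: "?Y k \<in> N \<rightarrow>\<^sub>M count_space UNIV" for k
    unfolding measurable_cong_sets[OF setsN refl] by measurable
  have subN: "subalgebra N (past N ?Y i)" for i by (rule subalgebra_past) (rule co)
  have AEN: "AE x in N. Q x" if "{x \<in> space ?P. Q x} \<in> sets ?P" "AE \<omega> in M. Q (?X \<omega>)" for Q
    unfolding N_def using AE_distr_iff[OF X that(1)] that(2) by blast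
  define v where "v i = real_cond_exp N (past N ?Y i) (indicator {x. x (Suc i) = x i})" for i
  have v_past: "v i \<in> borel_measurable (past N ?Y i)" for i unfolding v_def by simp
  have v_P [measurable]: "v i \<in> borel_measurable ?P" for i
    using measurable_from_subalg[OF subN v_past] unfolding measurable_cong_sets[OF setsN refl] .
  have c_P [measurable]: "real_cond_exp N (past N ?Y i) f \<in> borel_measurable ?P" for i f
    using measurable_from_subalg[OF subN borel_measurable_cond_exp]
    unfolding measurable_cong_sets[OF setsN refl] .
  have step_int: "integrable N (indicator {x. x (Suc i) = x i + d} :: _ \<Rightarrow> real)" for i d
  proof -
    have "{x \<in> space N. x (Suc i) = x i + d} \<in> sets N" by measurable
    then show ?thesis
      using N.emeasure_finite by (auto simp: spN simp: less_top[symmetric])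
  qed
  have pull: "AE \<omega> in M. real_cond_exp M (past M S i) (indicator {\<omega>. S (Suc i) \<omega> = S i \<omega> + d}) \<omega>
      = real_cond_exp N (past N ?Y i) (indicator {x. x (Suc i) = x i + d}) (?X \<omega>)" for i d
  proof -
    have eq: "(\<lambda>\<omega>. indicator {x. x (Suc i) = x i + d} (?X \<omega>) :: real)
        = indicator {\<omega>. S (Suc i) \<omega> = S i \<omega> + d}"
      by (auto simp: indicator_def fun_eq_iff)
    show ?thesis
      using cond_exp_pullback[OF M S N_def[THEN meta_eq_to_obj_eq] step_int[of i d], of i]
      unfolding eq .
  qed
  have vu: "AE \<omega> in M. v i (?X \<omega>) = u i \<omega>" for i
    using pull[of i 0] stay[of i] unfolding v_def by auto
  have "controlled_walk q N ?Y v"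
    unfolding controlled_walk_def admissible_control_def
  proof (intro conjI allI ballI)
    show "prob_space N" by unfold_locales
    show "?Y i \<in> N \<rightarrow>\<^sub>M count_space UNIV" for i by (rule co)
    show "v i \<in> borel_measurable (past N ?Y i)" for i by (rule v_past)
    show "AE x in N. v i x \<in> {0..q}" for i
    proof (rule AEN)
      show "{x \<in> space ?P. v i x \<in> {0..q}} \<in> sets ?P" by measurable
      show "AE \<omega> in M. v i (?X \<omega>) \<in> {0..q}" using vu[of i] uq[of i] by auto
    qed
    show "AE x in N. real_cond_exp N (past N ?Y i) (indicator {x. x (Suc i) = x i}) x = v i x" for i
      unfolding v_def by simp
    show "AE x in N. real_cond_exp N (past N ?Y i) (indicator {x. x (Suc i) = x i + d}) x
        = (1 - v i x) / 2" if d: "d \<in> {-1, 1}" for i d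
    proof (rule AEN)
      show "{x \<in> space ?P. real_cond_exp N (past N ?Y i) (indicator {x. x (Suc i) = x i + d}) x
          = (1 - v i x) / 2} \<in> sets ?P" by measurable
      show "AE \<omega> in M. real_cond_exp N (past N ?Y i) (indicator {x. x (Suc i) = x i + d}) (?X \<omega>)
          = (1 - v i (?X \<omega>)) / 2"
        using pull[of i d] move[OF d, of i] vu[of i] by auto
    qed
    show "AE x in N. x 0 = 0"
    proof (rule AEN)
      show "{x \<in> space ?P. x 0 = 0} \<in> sets ?P" by measurable
      show "AE \<omega> in M. ?X \<omega> 0 = 0" using S0 by simp
    qed
  qed
  then show "\<exists>v. controlled_walk q N ?Y v" by blast
  show meas: "measure N {x \<in> space N. x n = 0} = measure M {\<omega> \<in> space M. S n \<omega> = 0}"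
  proof -
    have "{x \<in> space N. x n = 0} \<in> sets N" by measurable
    then show ?thesis
      unfolding N_def by (subst measure_distr[OF X]) (auto simp: space_PiM intro!: arg_cong[where f = "measure M"])
  qed
  show "measure M {\<omega> \<in> space M. S n \<omega> = 0} \<in> return_probs q n"
    unfolding return_probs_def using \<open>controlled_walk q N ?Y v\<close> meas by force
qed

end

theory Submission
  imports Defs
begin

text \<open>
  By dynamic programming the supremum equals \<open>V\<^sub>n(0)\<close>, where \<open>V\<^sub>0\<close> is the indicator of \<open>0\<close> and
  \<open>V\<^sub>n\<^sub>+\<^sub>1 = max (A V\<^sub>n) (q V\<^sub>n + (1 - q) A V\<^sub>n)\<close> with \<open>A\<close> the nearest-neighbour average: it is optimal to be as
  lazy as possible exactly where \<open>V\<^sub>n \<ge> A V\<^sub>n\<close>.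

  Upper bound: \<open>t powr (-(1 - q)/8) * exp (-x\<^sup>2/(4t))\<close> is a supersolution of this recursion.

  Lower bound: seek subsolutions \<open>t powr (-\<sigma>) * \<phi> (x / sqrt t)\<close>. In the scaling limit the condition is
  \<open>max \<phi>'' ((1 - q) \<phi>'') + y \<phi>' + 2 \<sigma> \<phi> > 0\<close> on \<open>{\<phi> \<ge> 0}\<close>. For \<open>q = 0\<close> the Gaussian solves
  this with equality at \<open>\<sigma> = 1/2\<close>, and for \<open>q > 0\<close> the perturbation \<open>exp (-y\<^sup>2/2) * (1 - \<epsilon> ln (1 + y\<^sup>2))\<close> gives some
  \<open>\<sigma> < 1/2\<close>. For \<open>q\<close> near \<open>1\<close>, \<open>\<phi> y = - ln (2 (1 - q + y\<^sup>2))\<close>, which has a tall peak at \<open>0\<close>,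
  works with \<open>\<sigma>\<close> of order \<open>1 / ln (1/(1 - q))\<close>.
\<close>

section \<open>The value function\<close>

definition avg :: "(int \<Rightarrow> real) \<Rightarrow> int \<Rightarrow> real" where
  "avg f x = (f (x + 1) + f (x - 1)) / 2"

text \<open>The one-step mean \<open>u * f x + (1 - u) * avg f x\<close> is affine in
  \<open>u\<close>, so its maximum over controls in [0, q] sits at an endpoint, \<open>u = 0\<close>
  or \<open>u = q\<close>.\<close>

definition bellman :: "real \<Rightarrow> (int \<Rightarrow> real) \<Rightarrow> int \<Rightarrow> real" where
  "bellman q f x = max (avg f x) (q * f x + (1 - q) * avg f x)"

text \<open>The index counts the steps still to be taken, so time runs backwards along the
  recursion.\<close>

primrec opt_val :: "real \<Rightarrow> nat \<Rightarrow> int \<Rightarrow> real" where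
  "opt_val q 0 = (\<lambda>x. if x = 0 then 1 else 0)"
| "opt_val q (Suc n) = bellman q (opt_val q n)"

lemma bellman_mono:
  assumes "0 \<le> q" "q \<le> 1" "\<And>x. f x \<le> g x"
  shows "bellman q f x \<le> bellman q g x"
proof -
  have "avg f x \<le> avg g x" using assms(3)[of "x+1"] assms(3)[of "x-1"] by (simp add: avg_def)
  then show ?thesis unfolding bellman_def using assms
    by (intro max.mono add_mono mult_left_mono) auto
qed

lemma bellman_nonneg:
  assumes "0 \<le> q" "q \<le> 1" "\<And>x. 0 \<le> f x"
  shows "0 \<le> bellman q f x"
proof -
  have "0 \<le> avg f x" using assms by (simp add: avg_def)
  then show ?thesis by (simp add: bellman_def le_max_iff_disj)
qed

lemma bellman_scale:
  assumes "0 \<le> c"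
  shows "bellman q (\<lambda>x. c * f x) x = c * bellman q f x"
proof -
  have "avg (\<lambda>x. c * f x) x = c * avg f x" by (simp add: avg_def algebra_simps)
  then show ?thesis unfolding bellman_def using assms
    by (simp add: max_mult_distrib_left algebra_simps)
qed

lemma bellman_ge_control:
  assumes "0 \<le> u" "u \<le> q"
  shows "u * f x + (1 - u) * avg f x \<le> bellman q f x"
proof (cases "f x \<le> avg f x")
  case True
  then have "u * (f x - avg f x) \<le> 0" using assms by (simp add: mult_nonneg_nonpos)
  then show ?thesis by (simp add: bellman_def algebra_simps)
next
  case False
  then have "u * (f x - avg f x) \<le> q * (f x - avg f x)"
    using assms by (intro mult_right_mono) auto
  then show ?thesis by (simp add: bellman_def algebra_simps le_max_iff_disj)
qed

text \<open>Names the maximising endpoint; the optimal control is built from this rule.\<close>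

lemma bellman_eq_control:
  assumes "0 \<le> q"
  shows "bellman q f x = (if avg f x \<le> f x then q * f x + (1 - q) * avg f x else avg f x)"
proof (cases "avg f x \<le> f x")
  case True
  then have "0 \<le> q * (f x - avg f x)" using assms by auto
  then show ?thesis using True by (simp add: bellman_def algebra_simps)
next
  case False
  then have "q * (f x - avg f x) \<le> 0" using assms by (auto simp: mult_nonneg_nonpos)
  then show ?thesis using False by (simp add: bellman_def algebra_simps)
qed

lemma opt_val_bounds:
  assumes "0 \<le> q" "q \<le> 1"
  shows "0 \<le> opt_val q n x \<and> opt_val q n x \<le> 1"
proof (induction n arbitrary: x)
  case (Suc n)
  have "bellman q (opt_val q n) x \<le> bellman q (\<lambda>_. 1) x"
    using assms Suc by (intro bellman_mono) auto
  also have "\<dots> = 1" by (simp add: bellman_def avg_def)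
  finally show ?case using bellman_nonneg[OF assms, of "opt_val q n"] Suc by auto
qed simp

text \<open>Holding with weight \<open>q > 0\<close> removes the parity obstruction of the simple
  walk. The positivity starts the comparison in the lower bound.\<close>

lemma opt_val_pos:
  assumes "0 < q" "q < 1" "\<bar>x\<bar> \<le> int n"
  shows "0 < opt_val q n x"
  using assms(3)
proof (induction n arbitrary: x)
  case (Suc n)
  have nn: "0 \<le> opt_val q n y" for y using opt_val_bounds[of q n y] assms by auto
  have "0 < opt_val q n x \<or> 0 < opt_val q n (x + 1) \<or> 0 < opt_val q n (x - 1)"
  proof (cases "\<bar>x\<bar> \<le> int n")
    case False
    then have "\<bar>x + 1\<bar> \<le> int n \<or> \<bar>x - 1\<bar> \<le> int n" using Suc.prems by linarith
    then show ?thesis using Suc.IH by blast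
  qed (use Suc.IH in blast)
  moreover have "0 \<le> avg (opt_val q n) x" using nn by (simp add: avg_def)
  moreover have "0 < avg (opt_val q n) x" if "0 < opt_val q n (x + 1) \<or> 0 < opt_val q n (x - 1)"
    using that nn[of "x+1"] nn[of "x-1"] by (auto simp: avg_def)
  ultimately show ?case
    using assms nn[of x] by (auto simp: bellman_def less_max_iff_disj intro!: add_pos_nonneg)
qed auto

section \<open>Upper bound by a Gaussian supersolution\<close>

text \<open>The Gaussian has variance 2t, twice that of the simple walk. Its spreading from t to t +
  1 therefore absorbs the growth of the average in the tails, and a relative loss of 1/(8t) is left
  over. Averaging has weight at least 1 - q, whence the exponent (1 - q)/8.\<close>

lemma exp_supersolution:
  fixes x :: int and t :: real
  assumes q: "0 \<le> q" "q < 1" and t: "1 \<le> t"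
  defines "w \<equiv> \<lambda>t x. t powr (- ((1 - q) / 8)) * exp (- (real_of_int x)\<^sup>2 / (4 * t))"
  shows "bellman q (w t) x \<le> w (t + 1) x"
proof -
  define X where "X = real_of_int x"
  \<comment> \<open>\<open>r\<close> is the factor by which averaging multiplies \<open>w t\<close>
    at \<open>x\<close>; \<open>exp b\<close> is the factor gained there when the Gaussian widens
    from t to t + 1.\<close>
  define r where "r = exp (- 1 / (4 * t)) * cosh (X / (2 * t))"
  define b where "b = X\<^sup>2 / (4 * t * (t + 1))"
  have w0: "w t x > 0" using t by (simp add: w_def)
  have sh: "w t (x + d) = w t x * exp (- (2 * X * d + d * d) / (4 * t))" for d
  proof -
    have "- (real_of_int (x + d))\<^sup>2 / (4 * t) = - X\<^sup>2 / (4 * t) + - (2 * X * d + d * d) / (4 * t)"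
      by (simp add: X_def power2_eq_square field_simps add_divide_distrib[symmetric])
    then show ?thesis unfolding w_def X_def[symmetric] by (simp only: exp_add mult.assoc)
  qed
  have "avg (w t) x = w t x * r"
  proof -
    have "w t (x + 1) = w t x * (exp (- 1 / (4 * t)) * exp (- (X / (2 * t))))"
      unfolding sh[of 1] exp_add[symmetric] using t by (simp add: field_simps)
    moreover have "w t (x - 1) = w t x * (exp (- 1 / (4 * t)) * exp (X / (2 * t)))"
      using sh[of "-1"] unfolding exp_add[symmetric] using t by (simp add: field_simps)
    ultimately show ?thesis
      by (simp add: avg_def r_def cosh_field_def algebra_simps)
  qed
  then have bell: "bellman q (w t) x = w t x * max r (q + (1 - q) * r)"
    unfolding bellman_def using w0 by (simp add: max_mult_distrib_left algebra_simps)
  \<comment> \<open>Hoeffding's lemma for a fair sign: with probability 1/2 and range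
    \<open>2 * \<bar>z\<bar>\<close>, the quantity it bounds is
    \<open>ln (cosh \<bar>z\<bar>)\<close>.\<close>
  have cosh_le: "cosh z \<le> exp (z\<^sup>2 / 2)" for z :: real
  proof -
    have "cosh \<bar>z\<bar> \<le> exp (z\<^sup>2 / 2)"
    proof -
      have "1 + 1 / 2 * (exp (2 * \<bar>z\<bar>) - 1) = exp \<bar>z\<bar> * cosh \<bar>z\<bar>"
        by (simp add: cosh_field_def exp_double field_simps power2_eq_square flip: exp_add)
      then have "ln (1 + 1 / 2 * (exp (2 * \<bar>z\<bar>) - 1)) = \<bar>z\<bar> + ln (cosh \<bar>z\<bar>)"
        by (simp only: ln_mult_pos exp_gt_zero cosh_real_pos ln_exp)
      then have "ln (cosh \<bar>z\<bar>) \<le> z\<^sup>2 / 2"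
        using Hoeffdings_lemma_aux[of "2 * \<bar>z\<bar>" "1 / 2"] by (simp add: power_mult_distrib)
      then show ?thesis using exp_le_cancel_iff[of "ln (cosh \<bar>z\<bar>)"] cosh_real_pos[of "\<bar>z\<bar>"] by simp
    qed
    then show ?thesis by (cases "0 \<le> z") simp_all
  qed
  have "r \<le> exp (- 1 / (4 * t)) * exp ((X / (2 * t))\<^sup>2 / 2)"
    unfolding r_def by (intro mult_left_mono cosh_le) auto
  also have "(X / (2 * t))\<^sup>2 / 2 \<le> b"
  proof -
    \<comment> \<open>From \<open>t + 1 \<le> 2 * t\<close>. This is what the doubled variance buys:
      the tail growth of the average is at most \<open>b\<close>.\<close>
    have "4 * t * (t + 1) \<le> 8 * t\<^sup>2" using t by (simp add: power2_eq_square)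
    then have "X\<^sup>2 / (8 * t\<^sup>2) \<le> b" unfolding b_def using t by (intro divide_left_mono) auto
    then show ?thesis by (simp add: power_divide power_mult_distrib)
  qed
  finally have r: "r \<le> exp (- 1 / (4 * t)) * exp b" by simp
  have b0: "0 \<le> b" using t by (simp add: b_def)
  \<comment> \<open>The inequality exp(-s) \<le> 1 - s/2 for 0 < s \<le> 1, at s = 1/(4t).\<close>
  have e: "exp (- 1 / (4 * t)) \<le> 1 - 1 / (8 * t)"
  proof -
    have s: "1 / (4 * t) \<le> 1" "0 < 1 / (4 * t)" using t by auto
    have "1 \<le> (1 - (1 / (4 * t)) / 2) * (1 + 1 / (4 * t))"
      using s mult_left_le[of "1 / (4 * t)" "1 / (4 * t)"] by (simp add: algebra_simps)
    also have "\<dots> \<le> (1 - (1 / (4 * t)) / 2) * exp (1 / (4 * t))"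
      using s exp_ge_add_one_self[of "1 / (4 * t)"] by (intro mult_left_mono) auto
    finally show ?thesis by (simp add: exp_minus field_simps)
  qed
  have k: "max r (q + (1 - q) * r) \<le> exp (- ((1 - q) / 8) / t) * exp b"
  proof -
    have 1: "1 - (1 - q) / (8 * t) \<le> exp (- ((1 - q) / 8) / t)"
      using exp_ge_add_one_self[of "- ((1 - q) / 8) / t"] by simp
    have "r \<le> (1 - 1 / (8 * t)) * exp b" using r e by (meson exp_ge_zero mult_right_mono order_trans)
    moreover have "(1 - 1 / (8 * t)) \<le> 1 - (1 - q) / (8 * t)"
      using q t by (simp add: field_simps)
    ultimately have 2: "r \<le> (1 - (1 - q) / (8 * t)) * exp b"
      by (meson exp_ge_zero mult_right_mono order_trans)
    \<comment> \<open>In the lazy branch the held mass \<open>q\<close> is enlarged to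
      \<open>q * exp b\<close>, so that both terms carry the same factor
      \<open>exp b\<close>.\<close>
    have "q + (1 - q) * r \<le> q * exp b + (1 - q) * ((1 - 1 / (8 * t)) * exp b)"
      using q b0 \<open>r \<le> (1 - 1 / (8 * t)) * exp b\<close>
      by (intro add_mono mult_left_mono) (auto simp: mult_le_cancel_left1)
    also have "\<dots> = (1 - (1 - q) / (8 * t)) * exp b" by (simp add: field_simps)
    finally have "max r (q + (1 - q) * r) \<le> (1 - (1 - q) / (8 * t)) * exp b" using 2 by simp
    also have "\<dots> \<le> exp (- ((1 - q) / 8) / t) * exp b" using 1 by (intro mult_right_mono) auto
    finally show ?thesis .
  qed
  have "w (t + 1) x = w t x * ((1 + 1 / t) powr (- ((1 - q) / 8)) * exp b)"
  proof -
    have "t + 1 = t * (1 + 1 / t)" using t by (simp add: field_simps)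
    then have "(t + 1) powr (- ((1 - q) / 8)) = t powr (- ((1 - q) / 8)) * (1 + 1 / t) powr (- ((1 - q) / 8))"
      using t powr_mult[of t "1 + 1 / t"] by simp
    moreover have "- X\<^sup>2 / (4 * (t + 1)) = - X\<^sup>2 / (4 * t) + b"
      unfolding b_def using t by (simp add: divide_simps) (simp add: algebra_simps)
    ultimately show ?thesis unfolding w_def X_def[symmetric] by (simp only: exp_add mult_ac)
  qed
  moreover have e2: "exp (- ((1 - q) / 8) / t) \<le> (1 + 1 / t) powr (- ((1 - q) / 8))"
  proof -
    have "ln (1 + 1 / t) \<le> 1 / t" using t by (intro ln_add_one_self_le_self) auto
    then have "- ((1 - q) / 8) * (1 / t) \<le> - ((1 - q) / 8) * ln (1 + 1 / t)"
      using q by (intro mult_left_mono_neg) auto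
    moreover have "1 + 1 / t \<noteq> 0" using t by (simp add: field_simps)
    ultimately show ?thesis by (simp add: powr_def)
  qed
  moreover note order_trans[OF k mult_right_mono[OF e2 exp_ge_zero]]
  ultimately show ?thesis
    unfolding bell using w0 by (simp only: mult_le_cancel_left_pos)
qed

text \<open>The clock starts at 1, where the supersolution is available; at \<open>n = 0\<close> the
  bound equals 1 at the origin.\<close>

lemma opt_val_upper:
  assumes q: "0 \<le> q" "q < 1"
  shows "opt_val q n x \<le> real (n + 1) powr (- ((1 - q) / 8)) * exp (- (real_of_int x)\<^sup>2 / (4 * real (n + 1)))"
proof (induction n arbitrary: x)
  case (Suc n)
  have "opt_val q (Suc n) x \<le> bellman q (\<lambda>x. real (n + 1) powr (- ((1 - q) / 8)) * exp (- (real_of_int x)\<^sup>2 / (4 * real (n + 1)))) x"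
    using q Suc by (auto intro!: bellman_mono)
  also have "\<dots> \<le> (real (n + 1) + 1) powr (- ((1 - q) / 8)) * exp (- (real_of_int x)\<^sup>2 / (4 * (real (n + 1) + 1)))"
    by (rule exp_supersolution[OF q]) simp
  finally show ?case by (simp add: add_ac)
qed simp

section \<open>The optimally controlled walk\<close>

text \<open>Conditioning on the past replaces \<open>f\<close> of the next position by its mean over
  the increments -1, 0, 1. The point to establish is that almost surely no other increment
  occurs.\<close>

lemma controlled_walk_step:
  fixes f :: "int \<Rightarrow> real"
  assumes walk: "controlled_walk q M S u" and bound: "\<And>x. \<bar>f x\<bar> \<le> B"
  shows "(\<integral>\<omega>. f (S (Suc i) \<omega>) \<partial>M)
       = (\<integral>\<omega>. u i \<omega> * f (S i \<omega>) + (1 - u i \<omega>) * avg f (S i \<omega>) \<partial>M)"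
    (is "?lhs = ?rhs")
    and "integrable M (\<lambda>\<omega>. u i \<omega> * f (S i \<omega>) + (1 - u i \<omega>) * avg f (S i \<omega>))"
proof -
  have M: "prob_space M" and S [measurable]: "\<And>i. S i \<in> M \<rightarrow>\<^sub>M count_space UNIV"
    and u_past: "\<And>i. u i \<in> borel_measurable (past M S i)"
    and uq: "\<And>i. AE \<omega> in M. u i \<omega> \<in> {0..q}"
    and stay: "\<And>i. AE \<omega> in M. real_cond_exp M (past M S i)
                 (indicator {\<omega>. S (Suc i) \<omega> = S i \<omega>}) \<omega> = u i \<omega>"
    and move: "\<And>i d. d \<in> {-1, 1} \<Longrightarrow> AE \<omega> in M. real_cond_exp M (past M S i)
                 (indicator {\<omega>. S (Suc i) \<omega> = S i \<omega> + d}) \<omega> = (1 - u i \<omega>) / 2"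
    using walk unfolding controlled_walk_def admissible_control_def by blast+
  interpret prob_space M by fact
  have sub: "subalgebra M (past M S i)" by (rule subalgebra_past) (rule S)
  interpret C: finite_measure_subalgebra M "past M S i" by unfold_locales (rule sub)
  have u [measurable]: "u i \<in> borel_measurable M" by (rule measurable_from_subalg[OF sub u_past])
  have S_past: "S i \<in> past M S i \<rightarrow>\<^sub>M count_space UNIV"
    by (rule measurableI) (auto simp: sets_past intro!: sigma_sets.Basic)
  \<comment> \<open>\<open>I d\<close> marks the increment \<open>d\<close>, and \<open>K d\<close>
    is the conditional probability prescribed for it.\<close>
  define K where "K d = (\<lambda>\<omega>. if d = 0 then u i \<omega> else (1 - u i \<omega>) / 2)" for d :: int
  define I where "I d = (indicator {\<omega>. S (Suc i) \<omega> = S i \<omega> + d} :: _ \<Rightarrow> real)" for d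
  have I [measurable]: "I d \<in> borel_measurable M" for d
  proof -
    have "{\<omega> \<in> space M. S (Suc i) \<omega> = S i \<omega> + d} \<in> sets M" by measurable
    then show ?thesis unfolding I_def by (subst borel_measurable_indicator_iff) (simp add: Int_def conj_commute)
  qed
  have K [measurable]: "K d \<in> borel_measurable M" for d unfolding K_def by measurable
  \<comment> \<open>A function of \<open>S i\<close> is measurable with respect to the past, so it
    passes through the conditional expectation of \<open>I d\<close>.\<close>
  have key: "integrable M (\<lambda>\<omega>. g (S i \<omega>) * K d \<omega>) \<and>
      (\<integral>\<omega>. g (S i \<omega>) * K d \<omega> \<partial>M) = (\<integral>\<omega>. g (S i \<omega>) * I d \<omega> \<partial>M) \<and>
      integrable M (\<lambda>\<omega>. g (S i \<omega>) * I d \<omega>)"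
    if g: "\<And>x. \<bar>g x\<bar> \<le> B'" and d: "d \<in> {-1, 0, 1}" for g :: "int \<Rightarrow> real" and B' d
  proof -
    have gS: "(\<lambda>\<omega>. g (S i \<omega>)) \<in> borel_measurable (past M S i)"
      by (rule measurable_compose[OF S_past]) simp
    have B': "0 \<le> B'" using g[of 0] by linarith
    have int: "integrable M (\<lambda>\<omega>. g (S i \<omega>) * I d \<omega>)"
      by (rule integrable_const_bound[where B = B'])
         (use g B' in \<open>auto simp: I_def indicator_def\<close>)
    have ae: "AE \<omega> in M. real_cond_exp M (past M S i) (I d) \<omega> = K d \<omega>"
      using stay[of i] move[of d i] d by (auto simp: I_def K_def)
    note 1 = C.real_cond_exp_intg[OF int gS I]
    have "(\<integral>\<omega>. g (S i \<omega>) * K d \<omega> \<partial>M) = (\<integral>\<omega>. g (S i \<omega>) * real_cond_exp M (past M S i) (I d) \<omega> \<partial>M)"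
      by (rule integral_cong_AE) (use ae in auto)
    moreover have "integrable M (\<lambda>\<omega>. g (S i \<omega>) * K d \<omega>)"
      by (rule integrable_cong_AE_imp[OF 1(1)]) (use ae in auto)
    ultimately show ?thesis using 1(2) int by simp
  qed
  have K_sum: "K (-1) \<omega> + K 0 \<omega> + K 1 \<omega> = 1" for \<omega> by (simp add: K_def field_simps)
  \<comment> \<open>The three events are disjoint, so the sum of their indicators is at most 1; the
    prescribed probabilities add up to 1, so its mean is 1, and equality holds almost
    surely.\<close>
  have steps: "AE \<omega> in M. I (-1) \<omega> + I 0 \<omega> + I 1 \<omega> = 1"
  proof -
    have k: "integrable M (I d)" "(\<integral>\<omega>. K d \<omega> \<partial>M) = (\<integral>\<omega>. I d \<omega> \<partial>M)" "integrable M (K d)"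
      if "d \<in> {-1, 0, 1}" for d
      using key[of "\<lambda>_. 1" 1 d] that by auto
    have "(\<integral>\<omega>. 1 - (I (-1) \<omega> + I 0 \<omega> + I 1 \<omega>) \<partial>M) = 1 - (\<integral>\<omega>. K (-1) \<omega> + K 0 \<omega> + K 1 \<omega> \<partial>M)"
      using k by (simp add: prob_space)
    also have "\<dots> = 0" unfolding K_sum by (simp add: prob_space)
    finally have "(\<integral>\<omega>. 1 - (I (-1) \<omega> + I 0 \<omega> + I 1 \<omega>) \<partial>M) = 0" .
    moreover have "AE \<omega> in M. 0 \<le> 1 - (I (-1) \<omega> + I 0 \<omega> + I 1 \<omega>)"
      by (auto simp: I_def indicator_def)
    moreover have "integrable M (\<lambda>\<omega>. 1 - (I (-1) \<omega> + I 0 \<omega> + I 1 \<omega>))" using k by auto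
    ultimately have "AE \<omega> in M. 1 - (I (-1) \<omega> + I 0 \<omega> + I 1 \<omega>) = 0"
      by (subst (asm) integral_nonneg_eq_0_iff_AE)
    then show ?thesis by auto
  qed
  have f: "integrable M (\<lambda>\<omega>. f (S i \<omega> + d) * K d \<omega>)"
    "(\<integral>\<omega>. f (S i \<omega> + d) * K d \<omega> \<partial>M) = (\<integral>\<omega>. f (S i \<omega> + d) * I d \<omega> \<partial>M)"
    "integrable M (\<lambda>\<omega>. f (S i \<omega> + d) * I d \<omega>)"
    if "d \<in> {-1, 0, 1}" for d
    using key[of "\<lambda>x. f (x + d)" B d] bound that by auto
  have rhs: "(\<lambda>\<omega>. u i \<omega> * f (S i \<omega>) + (1 - u i \<omega>) * avg f (S i \<omega>)) =
    (\<lambda>\<omega>. f (S i \<omega> + -1) * K (-1) \<omega> + f (S i \<omega> + 0) * K 0 \<omega> + f (S i \<omega> + 1) * K 1 \<omega>)"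
    by (simp add: fun_eq_iff K_def avg_def field_simps)
  show "integrable M (\<lambda>\<omega>. u i \<omega> * f (S i \<omega>) + (1 - u i \<omega>) * avg f (S i \<omega>))"
    unfolding rhs using f(1)[of "-1"] f(1)[of 0] f(1)[of 1] by auto
  have "?lhs = (\<integral>\<omega>. f (S i \<omega> + -1) * I (-1) \<omega> + f (S i \<omega> + 0) * I 0 \<omega> + f (S i \<omega> + 1) * I 1 \<omega> \<partial>M)"
  proof (rule integral_cong_AE)
    show "AE \<omega> in M. f (S (Suc i) \<omega>) =
        f (S i \<omega> + -1) * I (-1) \<omega> + f (S i \<omega> + 0) * I 0 \<omega> + f (S i \<omega> + 1) * I 1 \<omega>"
      using steps by eventually_elim (auto simp: I_def indicator_def split: if_splits)
  qed measurable
  also have "\<dots> = ?rhs"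
    unfolding rhs using f[of "-1"] f[of 0] f[of 1] by simp
  finally show "?lhs = ?rhs" .
qed

lemma integrable_opt_val:
  assumes "0 \<le> q" "q \<le> 1" "prob_space M" "T \<in> M \<rightarrow>\<^sub>M count_space UNIV"
  shows "integrable M (\<lambda>\<omega>. opt_val q n (T \<omega>))"
proof -
  interpret prob_space M by fact
  have "(\<lambda>\<omega>. opt_val q n (T \<omega>)) \<in> borel_measurable M"
    by (rule measurable_compose[OF assms(4)]) simp
  then show ?thesis
    using opt_val_bounds[OF assms(1,2), of n]
    by (intro integrable_const_bound[where B = 1]) (auto simp: abs_le_iff intro: order_trans[of _ 0])
qed

text \<open>The two ends of the dynamic programming chain: no step left at time \<open>n\<close>,
  and \<open>n\<close> steps left at time 0.\<close>

lemma controlled_walk_prob_eq: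
  assumes "controlled_walk q M S u"
  shows "measure M {\<omega> \<in> space M. S n \<omega> = 0} = (\<integral>\<omega>. opt_val q 0 (S n \<omega>) \<partial>M)"
    and "(\<integral>\<omega>. opt_val q n (S 0 \<omega>) \<partial>M) = opt_val q n 0"
proof -
  have M: "prob_space M" and S [measurable]: "\<And>i. S i \<in> M \<rightarrow>\<^sub>M count_space UNIV"
    and S0: "AE \<omega> in M. S 0 \<omega> = 0"
    using assms unfolding controlled_walk_def by blast+
  interpret prob_space M by fact
  have "{\<omega> \<in> space M. S n \<omega> = 0} \<in> events" by measurable
  moreover have "(\<integral>\<omega>. opt_val q 0 (S n \<omega>) \<partial>M) = (\<integral>\<omega>. indicator {\<omega> \<in> space M. S n \<omega> = 0} \<omega> \<partial>M)"
    by (rule Bochner_Integration.integral_cong) (auto simp: indicator_def)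
  ultimately show "measure M {\<omega> \<in> space M. S n \<omega> = 0} = (\<integral>\<omega>. opt_val q 0 (S n \<omega>) \<partial>M)"
    by simp
  have "(\<integral>\<omega>. opt_val q n (S 0 \<omega>) \<partial>M) = (\<integral>\<omega>. opt_val q n 0 \<partial>M)"
    by (rule integral_cong_AE) (use S0 in \<open>auto intro: measurable_compose[OF S]\<close>)
  then show "(\<integral>\<omega>. opt_val q n (S 0 \<omega>) \<partial>M) = opt_val q n 0" by (simp add: prob_space)
qed

text \<open>No control beats \<open>bellman\<close>, so the mean of the value function along the
  walk can only decrease in time. \<open>k\<close> counts the steps left, and the induction moves
  back from the terminal time.\<close>

lemma controlled_walk_prob_le:
  assumes q: "0 \<le> q" "q \<le> 1" and walk: "controlled_walk q M S u"
  shows "measure M {\<omega> \<in> space M. S n \<omega> = 0} \<le> opt_val q n 0"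
proof -
  have M: "prob_space M" and S [measurable]: "\<And>i. S i \<in> M \<rightarrow>\<^sub>M count_space UNIV"
    and uq: "\<And>i. AE \<omega> in M. u i \<omega> \<in> {0..q}"
    using walk unfolding controlled_walk_def admissible_control_def by blast+
  have "(\<integral>\<omega>. opt_val q 0 (S n \<omega>) \<partial>M) \<le> (\<integral>\<omega>. opt_val q k (S (n - k) \<omega>) \<partial>M)" if "k \<le> n" for k
    using that
  proof (induction k)
    case (Suc k)
    have b: "\<bar>opt_val q k x\<bar> \<le> 1" for x using opt_val_bounds[OF q, of k x] by auto
    have n: "n - k = Suc (n - Suc k)" using Suc.prems by simp
    note step = controlled_walk_step[where f = "opt_val q k" and i = "n - Suc k", OF walk b]
    have "(\<integral>\<omega>. opt_val q 0 (S n \<omega>) \<partial>M) \<le> (\<integral>\<omega>. opt_val q k (S (n - k) \<omega>) \<partial>M)" using Suc by simp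
    also have "\<dots> \<le> (\<integral>\<omega>. opt_val q (Suc k) (S (n - Suc k) \<omega>) \<partial>M)"
      unfolding n
    proof (subst step(1), rule integral_mono_AE[OF step(2) integrable_opt_val[OF q M S]])
      show "AE \<omega> in M. u (n - Suc k) \<omega> * opt_val q k (S (n - Suc k) \<omega>) +
          (1 - u (n - Suc k) \<omega>) * avg (opt_val q k) (S (n - Suc k) \<omega>)
          \<le> opt_val q (Suc k) (S (n - Suc k) \<omega>)"
        using uq[of "n - Suc k"] by eventually_elim (simp add: bellman_ge_control)
    qed
    finally show ?case .
  qed simp
  from this[of n] show ?thesis
    using controlled_walk_prob_eq[OF walk, of n] by simp
qed

section \<open>Realising two-valued controls by coin tosses\<close>

text \<open>Each \<open>\<omega> i\<close> is a pair of coins: the first decides whether to hold and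
  is consulted only where \<open>slow\<close> is true, the second gives the direction.\<close>

primrec bang_walk :: "(nat \<Rightarrow> int \<Rightarrow> bool) \<Rightarrow> nat \<Rightarrow> (nat \<Rightarrow> bool \<times> bool) \<Rightarrow> int" where
  "bang_walk slow 0 \<omega> = 0"
| "bang_walk slow (Suc i) \<omega> = bang_walk slow i \<omega> +
     (if slow i (bang_walk slow i \<omega>) \<and> fst (\<omega> i) then 0 else if snd (\<omega> i) then 1 else - 1)"

text \<open>The position at time \<open>j\<close> reads only the coins before \<open>j\<close>. This
  will make coin \<open>j\<close> independent of the past up to \<open>j\<close>.\<close>

lemma bang_walk_restrict:
  "{..<j} \<subseteq> I \<Longrightarrow> bang_walk slow j (restrict \<omega> I) = bang_walk slow j \<omega>"
  by (induction j) (auto simp: lessThan_Suc)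

lemma measurable_bang_walk:
  "{..<j} \<subseteq> I \<Longrightarrow> bang_walk slow j \<in> PiM I (\<lambda>_. count_space UNIV) \<rightarrow>\<^sub>M count_space UNIV"
proof (induction j)
  case (Suc j)
  then have [measurable]: "bang_walk slow j \<in> PiM I (\<lambda>_. count_space UNIV) \<rightarrow>\<^sub>M count_space UNIV"
    and j: "j \<in> I" by (auto simp: lessThan_Suc)
  have [measurable]: "(\<lambda>\<omega>. \<omega> j) \<in> PiM I (\<lambda>_. count_space UNIV) \<rightarrow>\<^sub>M (count_space UNIV :: (bool \<times> bool) measure)"
    using j by measurable
  have "(\<lambda>\<omega>. bang_walk slow (Suc j) \<omega>) \<in> PiM I (\<lambda>_. count_space UNIV) \<rightarrow>\<^sub>M count_space UNIV"
    unfolding bang_walk.simps by measurable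
  then show ?case .
next
  case 0
  have "(\<lambda>\<omega>. bang_walk slow 0 \<omega>) \<in> PiM I (\<lambda>_. count_space UNIV) \<rightarrow>\<^sub>M count_space UNIV"
    unfolding bang_walk.simps by measurable
  then show ?case .
qed

text \<open>Since coin \<open>i\<close> is independent of the past up to \<open>i\<close>, the
  conditional law of the next increment is that of one coin pair with the value of
  \<open>slow\<close> frozen at the current position.\<close>

lemma bang_walk_controlled:
  assumes q: "0 \<le> q" "q \<le> 1"
  obtains M where "controlled_walk q M (bang_walk slow)
    (\<lambda>i \<omega>. if slow i (bang_walk slow i \<omega>) then q else 0)"
proof -
  define p where "p = pair_pmf (bernoulli_pmf q) (bernoulli_pmf (1 / 2))"
  define M where "M = PiM (UNIV :: nat set) (\<lambda>_. measure_pmf p)"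
  let ?S = "bang_walk slow"
  let ?u = "\<lambda>i \<omega>. if slow i (?S i \<omega>) then q else 0"
  let ?F = "past M ?S"
  interpret prob_space M unfolding M_def by (intro prob_space_PiM prob_space_measure_pmf)
  have sp: "space M = UNIV" by (simp add: M_def space_PiM)
  have sets_PiM': "sets (PiM I (\<lambda>_. measure_pmf p)) = sets (PiM I (\<lambda>_. count_space UNIV))" for I :: "nat set"
    by (intro sets_PiM_cong) auto
  have sets_M: "sets M = sets (PiM UNIV (\<lambda>_. count_space UNIV))" by (simp add: M_def sets_PiM')
  have S [measurable]: "?S i \<in> M \<rightarrow>\<^sub>M count_space UNIV" for i
    unfolding measurable_cong_sets[OF sets_M refl] by (rule measurable_bang_walk) simp
  have co [measurable]: "(\<lambda>\<omega>. \<omega> i) \<in> M \<rightarrow>\<^sub>M measure_pmf p" for i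
    unfolding M_def by measurable
  have co' [measurable]: "(\<lambda>\<omega>. \<omega> i) \<in> M \<rightarrow>\<^sub>M count_space UNIV" for i
    using co by simp
  have sub: "subalgebra M (?F i)" for i by (rule subalgebra_past) (rule S)
  have S_past: "?S i \<in> ?F i \<rightarrow>\<^sub>M count_space UNIV" for i
    by (rule measurableI) (auto simp: sets_past intro!: sigma_sets.Basic)
  have distr_co: "distr M (measure_pmf p) (\<lambda>\<omega>. \<omega> i) = measure_pmf p" for i
    unfolding M_def by (rule distr_PiM_component) (auto simp: prob_space_measure_pmf)
  have prob_co: "prob {\<omega> \<in> space M. \<omega> i \<in> X} = measure p X" for i X
  proof -
    have "measure p X = measure (distr M (measure_pmf p) (\<lambda>\<omega>. \<omega> i)) X" by (simp only: distr_co)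
    also have "\<dots> = prob ((\<lambda>\<omega>. \<omega> i) -` X \<inter> space M)" by (rule measure_distr) auto
    also have "(\<lambda>\<omega>. \<omega> i) -` X \<inter> space M = {\<omega> \<in> space M. \<omega> i \<in> X}" by auto
    finally show ?thesis by simp
  qed
  have iv: "indep_vars (\<lambda>_. measure_pmf p) (\<lambda>i \<omega>. \<omega> i) UNIV"
  proof (subst indep_vars_iff_distr_eq_PiM)
    show "distr M (PiM UNIV (\<lambda>_. measure_pmf p)) (\<lambda>x. \<lambda>i\<in>UNIV. x i)
        = PiM UNIV (\<lambda>i. distr M (measure_pmf p) (\<lambda>\<omega>. \<omega> i))"
      unfolding distr_co by (simp add: M_def[symmetric] distr_id2 restrict_UNIV)
  qed auto
  have indep: "prob (A \<inter> {\<omega> \<in> space M. \<omega> i \<in> X}) = prob A * measure p X" if A: "A \<in> sets (?F i)" for A i X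
  proof -
    let ?P = "PiM {..<i} (\<lambda>_. measure_pmf p)" and ?R = "\<lambda>\<omega> :: nat \<Rightarrow> bool \<times> bool. restrict \<omega> {..<i}"
    \<comment> \<open>Every generator, including the one with \<open>j = i\<close>, reads only coins
      of index below \<open>i\<close>, so the past is contained in the sigma-algebra of the first
      \<open>i\<close> coins.\<close>
    have "sigma_sets (space M) {?S j -` B \<inter> space M | j B. j \<le> i} \<subseteq> {?R -` B \<inter> space M | B. B \<in> sets ?P}"
    proof -
      have "?R \<in> space M \<rightarrow> space ?P" by (auto simp: space_PiM)
      then have V: "sets (vimage_algebra (space M) ?R ?P) = {?R -` B \<inter> space M | B. B \<in> sets ?P}"
        by (rule sets_vimage_algebra2)
      have "{?S j -` B \<inter> space M | j B. j \<le> i} \<subseteq> sets (vimage_algebra (space M) ?R ?P)"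
        unfolding V
      proof safe
        fix j B assume j: "j \<le> i"
        have "?S j -` B \<inter> space ?P \<in> sets ?P"
          by (rule measurable_sets[where A = "count_space UNIV"])
             (use j in \<open>auto simp: measurable_cong_sets[OF sets_PiM' refl] intro!: measurable_bang_walk\<close>)
        moreover have "?S j -` B \<inter> space M = ?R -` (?S j -` B \<inter> space ?P) \<inter> space M"
          using j bang_walk_restrict[of j "{..<i}" slow] by (auto simp: space_PiM)
        ultimately show "\<exists>B'. ?S j -` B \<inter> space M = ?R -` B' \<inter> space M \<and> B' \<in> sets ?P" by blast
      qed
      from sets.sigma_sets_subset[OF this] show ?thesis unfolding V by simp
    qed
    then obtain B where B: "B \<in> sets ?P" "A = ?R -` B \<inter> space M" using A unfolding sets_past by blast
    let ?Q = "PiM {i} (\<lambda>_. measure_pmf p)" and ?R' = "\<lambda>\<omega> :: nat \<Rightarrow> bool \<times> bool. restrict \<omega> {i}"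
    let ?X = "(\<lambda>\<omega>. \<omega> i) -` X \<inter> space ?Q"
    have iv2: "indep_var ?P ?R ?Q ?R'"
      by (rule indep_var_restrict[OF iv]) auto
    have X: "?X \<in> sets ?Q"
    proof (rule measurable_sets[where A = "measure_pmf p"])
      show "(\<lambda>\<omega>. \<omega> i) \<in> ?Q \<rightarrow>\<^sub>M measure_pmf p" by (rule measurable_component_singleton) simp
    qed simp
    have 1: "{\<omega> \<in> space M. \<omega> i \<in> X} = ?R' -` ?X \<inter> space M" by (auto simp: space_PiM)
    have "A \<inter> {\<omega> \<in> space M. \<omega> i \<in> X} = (\<lambda>\<omega>. (?R \<omega>, ?R' \<omega>)) -` (B \<times> ?X) \<inter> space M"
      unfolding 1 B(2) by auto
    then have "prob (A \<inter> {\<omega> \<in> space M. \<omega> i \<in> X}) = prob A * prob {\<omega> \<in> space M. \<omega> i \<in> X}"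
      using indep_varD[OF iv2 B(1) X] unfolding 1 B(2) by simp
    then show ?thesis by (simp add: prob_co)
  qed
  define step where "step b w = (if b \<and> fst w then 0 else if snd w then 1 else (- 1 :: int))" for b and w :: "bool \<times> bool"
  define k where "k b d = measure p {w. step b w = d}" for b d
  have S_Suc: "?S (Suc i) \<omega> = ?S i \<omega> + step (slow i (?S i \<omega>)) (\<omega> i)" for i \<omega>
    by (simp add: step_def)
  have ce: "AE \<omega> in M. real_cond_exp M (?F i) (indicator {\<omega>. ?S (Suc i) \<omega> = ?S i \<omega> + d}) \<omega>
      = k (slow i (?S i \<omega>)) d" for i d
  proof -
    interpret C: finite_measure_subalgebra M "?F i" by unfold_locales (rule sub)
    let ?E = "{\<omega>. ?S (Suc i) \<omega> = ?S i \<omega> + d}" and ?g = "\<lambda>\<omega>. k (slow i (?S i \<omega>)) d"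
    have E: "?E \<in> events"
    proof -
      have "{\<omega> \<in> space M. ?S (Suc i) \<omega> = ?S i \<omega> + d} \<in> events" by measurable
      then show ?thesis by (simp add: sp)
    qed
    have g: "?g \<in> borel_measurable (?F i)" by (rule measurable_compose[OF S_past]) simp
    have gM [measurable]: "?g \<in> borel_measurable M" by (rule measurable_from_subalg[OF sub g])
    have k1: "\<bar>k b d\<bar> \<le> 1" for b by (simp add: k_def)
    show ?thesis
    proof (rule C.real_cond_exp_charact)
      show "integrable M (indicator ?E :: _ \<Rightarrow> real)" using E by (simp add: less_top[symmetric])
      show "integrable M ?g" by (rule integrable_const_bound[where B = 1]) (auto simp: k1)
      show "?g \<in> borel_measurable (?F i)" by (rule g)
      fix A assume A: "A \<in> sets (?F i)"
      let ?L = "\<lambda>b. {\<omega> \<in> space (?F i). slow i (?S i \<omega>) = b}"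
      have L: "?L b \<in> sets (?F i)" for b
      proof -
        have "?S i -` {x. slow i x = b} \<inter> space (?F i) \<in> sets (?F i)" by (rule measurable_sets[OF S_past]) simp
        then show ?thesis by (simp add: vimage_def Int_def conj_commute)
      qed
      have AL: "A \<inter> ?L b \<in> sets (?F i)" for b using A L by auto
      have ev: "X \<in> sets (?F i) \<Longrightarrow> X \<in> events" for X using sub[of i] by (auto simp: subalgebra_def)
      have AM: "A \<in> events" using ev A by blast
      \<comment> \<open>\<open>A\<close> is cut by the value of \<open>slow\<close> at the current
        position. On each piece the event concerns coin \<open>i\<close> alone, so
        \<open>indep\<close> applies.\<close>
      have split: "A \<inter> ?E = (A \<inter> ?L True \<inter> {\<omega> \<in> space M. \<omega> i \<in> {w. step True w = d}}) \<union>
          (A \<inter> ?L False \<inter> {\<omega> \<in> space M. \<omega> i \<in> {w. step False w = d}})"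
      proof (rule set_eqI)
        fix \<omega>
        show "\<omega> \<in> A \<inter> ?E \<longleftrightarrow> \<omega> \<in> (A \<inter> ?L True \<inter> {\<omega> \<in> space M. \<omega> i \<in> {w. step True w = d}}) \<union>
          (A \<inter> ?L False \<inter> {\<omega> \<in> space M. \<omega> i \<in> {w. step False w = d}})"
          unfolding S_Suc by (cases "slow i (?S i \<omega>)") (auto simp: sp)
      qed
      have m: "{\<omega> \<in> space M. \<omega> i \<in> X} \<in> events" for X by measurable
      have "(\<integral>\<omega>\<in>A. indicator ?E \<omega> \<partial>M) = (\<integral>\<omega>. indicator (A \<inter> ?E) \<omega> \<partial>M)"
        unfolding set_lebesgue_integral_def by (rule Bochner_Integration.integral_cong) (auto simp: indicator_def)
      also have "\<dots> = prob (A \<inter> ?E)" by (simp add: sp)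
      also have "\<dots> = prob (A \<inter> ?L True \<inter> {\<omega> \<in> space M. \<omega> i \<in> {w. step True w = d}}) +
          prob (A \<inter> ?L False \<inter> {\<omega> \<in> space M. \<omega> i \<in> {w. step False w = d}})"
        unfolding split by (rule finite_measure_Union[OF sets.Int[OF ev[OF AL] m] sets.Int[OF ev[OF AL] m]]) auto
      also have "\<dots> = prob (A \<inter> ?L True) * k True d + prob (A \<inter> ?L False) * k False d"
        by (simp only: indep[OF AL] k_def)
      also have "\<dots> = (\<integral>\<omega>. indicator (A \<inter> ?L True) \<omega> * k True d + indicator (A \<inter> ?L False) \<omega> * k False d \<partial>M)"
        using ev[OF AL, of True] ev[OF AL, of False] by (simp add: sp less_top[symmetric])
      also have "\<dots> = (\<integral>\<omega>\<in>A. ?g \<omega> \<partial>M)"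
        unfolding set_lebesgue_integral_def by (rule Bochner_Integration.integral_cong) (auto simp: indicator_def sp)
      finally show "(\<integral>\<omega>\<in>A. indicator ?E \<omega> \<partial>M) = (\<integral>\<omega>\<in>A. ?g \<omega> \<partial>M)" .
    qed
  qed
  have pq: "measure p {w. P w} = (if P (True, True) then q / 2 else 0) + (if P (True, False) then q / 2 else 0)
     + (if P (False, True) then (1 - q) / 2 else 0) + (if P (False, False) then (1 - q) / 2 else 0)" for P
  proof -
    have "measure p {w. P w} = (\<Sum>w\<in>{w. P w}. pmf p w)" by (simp add: measure_measure_pmf_finite)
    also have "\<dots> = (\<Sum>w\<in>UNIV. if P w then pmf p w else 0)" by (simp add: sum.If_cases)
    also have "(UNIV :: (bool \<times> bool) set) = {(True, True), (True, False), (False, True), (False, False)}" by auto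
    finally show ?thesis using q by (simp add: p_def pmf_pair)
  qed
  have k: "k True 0 = q" "k False 0 = 0" "d \<in> {-1, 1} \<Longrightarrow> k True d = (1 - q) / 2"
    "d \<in> {-1, 1} \<Longrightarrow> k False d = 1 / 2" for d
    unfolding k_def pq step_def by (auto simp: field_simps)
  have "controlled_walk q M ?S ?u"
    unfolding controlled_walk_def admissible_control_def
  proof (intro conjI allI ballI)
    show "prob_space M" by unfold_locales
    show "?S i \<in> M \<rightarrow>\<^sub>M count_space UNIV" for i by (rule S)
    show "AE \<omega> in M. ?S 0 \<omega> = 0" by simp
    show "?u i \<in> borel_measurable (?F i)" for i
      using measurable_compose[OF S_past, of "\<lambda>x. if slow i x then q else 0" borel i] by simp
    show "AE \<omega> in M. ?u i \<omega> \<in> {0..q}" for i using q by auto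
    show "AE \<omega> in M. real_cond_exp M (?F i) (indicator {\<omega>. ?S (Suc i) \<omega> = ?S i \<omega>}) \<omega> = ?u i \<omega>" for i
      using ce[of i 0] by eventually_elim (auto simp: k simp del: bang_walk.simps)
    show "AE \<omega> in M. real_cond_exp M (?F i) (indicator {\<omega>. ?S (Suc i) \<omega> = ?S i \<omega> + d}) \<omega> = (1 - ?u i \<omega>) / 2"
      if "d \<in> {-1, 1}" for i d
      using ce[of i d] by eventually_elim (auto simp: k(3,4)[OF that] simp del: bang_walk.simps)
  qed
  then show ?thesis by (rule that)
qed

text \<open>Under the greedy rule every inequality of the dynamic programming chain becomes an
  equality, so the bound is attained.\<close>

lemma opt_val_in_return_probs:
  assumes q: "0 \<le> q" "q \<le> 1"
  shows "opt_val q n 0 \<in> return_probs q n"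
proof -
  \<comment> \<open>After the step that leaves time \<open>i\<close> there remain
    \<open>n - Suc i\<close> further steps; the walk is lazy where their value at the current site
    is at least the neighbour average.\<close>
  define slow where "slow i x \<longleftrightarrow> avg (opt_val q (n - Suc i)) x \<le> opt_val q (n - Suc i) x" for i x
  obtain M where walk: "controlled_walk q M (bang_walk slow) (\<lambda>i \<omega>. if slow i (bang_walk slow i \<omega>) then q else 0)"
    using bang_walk_controlled[OF q] by blast
  let ?S = "bang_walk slow"
  have "(\<integral>\<omega>. opt_val q 0 (?S n \<omega>) \<partial>M) = (\<integral>\<omega>. opt_val q k (?S (n - k) \<omega>) \<partial>M)" if "k \<le> n" for k
    using that
  proof (induction k)
    case (Suc k)
    have b: "\<bar>opt_val q k x\<bar> \<le> 1" for x using opt_val_bounds[OF q, of k x] by auto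
    have n: "n - k = Suc (n - Suc k)" "n - Suc (n - Suc k) = k" using Suc.prems by auto
    have "(\<integral>\<omega>. opt_val q 0 (?S n \<omega>) \<partial>M) = (\<integral>\<omega>. opt_val q k (?S (n - k) \<omega>) \<partial>M)" using Suc by simp
    also have "\<dots> = (\<integral>\<omega>. opt_val q (Suc k) (?S (n - Suc k) \<omega>) \<partial>M)"
      unfolding n(1)
      by (subst controlled_walk_step(1)[where f = "opt_val q k" and i = "n - Suc k", OF walk b],
          rule Bochner_Integration.integral_cong)
         (use q in \<open>auto simp: slow_def n(2) bellman_eq_control\<close>)
    finally show ?case .
  qed simp
  from this[of n] have "measure M {\<omega> \<in> space M. ?S n \<omega> = 0} = opt_val q n 0"
    using controlled_walk_prob_eq[OF walk, of n] by simp
  \<comment> \<open>The walk lives on coin sequences; its law on integer sequences supplies the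
    member of \<open>return_probs\<close>.\<close>
  then show ?thesis using controlled_walk_canonical(3)[OF walk, of n] by simp
qed

lemma sup_return_prob_eq:
  assumes "0 \<le> q" "q \<le> 1"
  shows "sup_return_prob q n = opt_val q n 0"
  unfolding sup_return_prob_def
  by (rule cSup_eq_maximum[OF opt_val_in_return_probs[OF assms]])
     (auto simp: return_probs_def intro: controlled_walk_prob_le[OF assms])

section \<open>Self-similar subsolutions\<close>

text \<open>Taylor expansion to the right and to the left: the first-order terms cancel, and each
  Lagrange remainder brings its own intermediate point.\<close>

lemma second_difference:
  fixes f f' f'' :: "real \<Rightarrow> real"
  assumes f: "\<And>y. (f has_real_derivative f' y) (at y)"
    and f': "\<And>y. (f' has_real_derivative f'' y) (at y)"
    and k: "0 < k"
  shows "\<exists>\<xi> \<eta>. \<bar>\<xi> - z\<bar> \<le> k \<and> \<bar>\<eta> - z\<bar> \<le> k \<and> f (z + k) + f (z - k) - 2 * f z = k\<^sup>2 * (f'' \<xi> + f'' \<eta>) / 2"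
proof -
  define diff where "diff m = (if m = 0 then f else if m = 1 then f' else f'')" for m :: nat
  have d: "\<forall>m t. m < 2 \<and> z - k \<le> t \<and> t \<le> z + k \<longrightarrow> DERIV (diff m) t :> diff (Suc m) t"
    using f f' by (auto simp: diff_def less_2_cases_iff)
  have T: "\<exists>t. \<bar>t - z\<bar> \<le> k \<and> f x = f z + f' z * (x - z) + f'' t / 2 * (x - z)\<^sup>2"
    if "x = z + k \<or> x = z - k" for x
  proof -
    have "\<exists>t. (if x < z then x < t \<and> t < z else z < t \<and> t < x) \<and>
      f x = (\<Sum>m<2. diff m z / fact m * (x - z) ^ m) + diff 2 t / fact 2 * (x - z)\<^sup>2"
      by (rule Taylor[OF _ _ d]) (use k that in \<open>auto simp: diff_def\<close>)
    then obtain t where t: "if x < z then x < t \<and> t < z else z < t \<and> t < x"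
      "f x = (\<Sum>m<2. diff m z / fact m * (x - z) ^ m) + diff 2 t / fact 2 * (x - z)\<^sup>2" by blast
    have "f x = f z + f' z * (x - z) + f'' t / 2 * (x - z)\<^sup>2"
      using t(2) by (simp add: diff_def numeral_2_eq_2)
    moreover have "\<bar>t - z\<bar> \<le> k" using t(1) that k by (auto split: if_splits)
    ultimately show ?thesis by blast
  qed
  from T[of "z + k"] T[of "z - k"] obtain \<xi> \<eta> where
    "\<bar>\<xi> - z\<bar> \<le> k" "f (z + k) = f z + f' z * k + f'' \<xi> / 2 * k\<^sup>2"
    "\<bar>\<eta> - z\<bar> \<le> k" "f (z - k) = f z - f' z * k + f'' \<eta> / 2 * k\<^sup>2" by auto
  then show ?thesis by (intro exI[of _ \<xi>] exI[of _ \<eta>]) (auto simp: algebra_simps)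
qed

definition selfsim :: "real \<Rightarrow> (real \<Rightarrow> real) \<Rightarrow> real \<Rightarrow> real \<Rightarrow> real" where
  "selfsim \<sigma> \<phi> t x = t powr (- \<sigma>) * \<phi> (x / sqrt t)"

text \<open>Mean value theorem in \<open>t\<close>; the right-hand side is the time derivative at
  the intermediate time.\<close>

lemma selfsim_time_increment:
  assumes f: "\<And>y. (\<phi> has_real_derivative \<phi>' y) (at y)" and t: "0 < t"
  shows "\<exists>\<tau>. t < \<tau> \<and> \<tau> < t + 1 \<and> selfsim \<sigma> \<phi> (t + 1) x - selfsim \<sigma> \<phi> t x
     = - (\<tau> powr (- \<sigma> - 1)) * (\<sigma> * \<phi> (x / sqrt \<tau>) + x / sqrt \<tau> * \<phi>' (x / sqrt \<tau>) / 2)"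
proof -
  have "\<exists>\<tau>>t. \<tau> < t + 1 \<and> selfsim \<sigma> \<phi> (t + 1) x - selfsim \<sigma> \<phi> t x = (t + 1 - t) *
     (- (\<tau> powr (- \<sigma> - 1)) * (\<sigma> * \<phi> (x / sqrt \<tau>) + x / sqrt \<tau> * \<phi>' (x / sqrt \<tau>) / 2))"
  proof (rule MVT2)
    fix s assume "t \<le> s"
    then have s: "0 < s" using t by simp
    have "((\<lambda>s. x / sqrt s) has_real_derivative (- x / (2 * s * sqrt s))) (at s)"
      using s by (auto intro!: derivative_eq_intros simp: field_simps)
    note c = DERIV_chain2[OF f this]
    show "((\<lambda>s. selfsim \<sigma> \<phi> s x) has_real_derivative
      (- (s powr (- \<sigma> - 1)) * (\<sigma> * \<phi> (x / sqrt s) + x / sqrt s * \<phi>' (x / sqrt s) / 2))) (at s)"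
      unfolding selfsim_def
      by (rule DERIV_cong[OF DERIV_mult[OF has_real_derivative_powr[OF s] c]])
         (use s in \<open>simp add: field_simps powr_diff\<close>)
  qed simp
  then show ?thesis by auto
qed

text \<open>
  A failure of the discrete inequality at times tending to infinity would, along a subsequence of the rescaled
  positions, contradict the strict differential inequality at the limit point.
\<close>
lemma discrete_subsolution:
  fixes \<phi> \<phi>' \<phi>'' :: "real \<Rightarrow> real"
  assumes f: "\<And>y. (\<phi> has_real_derivative \<phi>' y) (at y)"
    and f': "\<And>y. (\<phi>' has_real_derivative \<phi>'' y) (at y)"
    and cont: "continuous_on UNIV \<phi>''"
    and bdd: "\<And>y. 0 \<le> \<phi> y \<Longrightarrow> \<bar>y\<bar> \<le> R"
    and strict: "\<And>y. 0 \<le> \<phi> y \<Longrightarrow> 0 < max (\<phi>'' y) ((1 - q) * \<phi>'' y) + y * \<phi>' y + 2 * \<sigma> * \<phi> y"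
  shows "\<exists>a\<ge>1. \<forall>t\<ge>a. \<forall>x. 0 \<le> selfsim \<sigma> \<phi> (t + 1) (real_of_int x) \<longrightarrow>
     selfsim \<sigma> \<phi> (t + 1) (real_of_int x) \<le> bellman q (\<lambda>x. selfsim \<sigma> \<phi> t (real_of_int x)) x"
proof (rule ccontr)
  define w where "w = (\<lambda>t x. selfsim \<sigma> \<phi> t (real_of_int x))"
  define D where "D m = max m ((1 - q) * m)" for m
  assume neg: "\<not> ?thesis"
  \<comment> \<open>A failure beyond every threshold gives a sequence of violations with times
    tending to infinity.\<close>
  have "\<exists>t x. real n + 1 \<le> t \<and> 0 \<le> w (t + 1) x \<and> bellman q (w t) x < w (t + 1) x" for n
    using neg unfolding w_def not_ex not_all de_Morgan_conj not_imp not_le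
    by (elim allE[of _ "real n + 1"]) auto
  then obtain t x where t: "\<And>n. real n + 1 \<le> t n"
    and pos: "\<And>n. 0 \<le> w (t n + 1) (x n)" and viol: "\<And>n. bellman q (w (t n)) (x n) < w (t n + 1) (x n)"
    by metis
  have t0: "0 < t n" "1 \<le> t n" for n using t[of n] by linarith+
  define X where "X n = real_of_int (x n)" for n
  \<comment> \<open>Scaled by the later time \<open>t n + 1\<close>, where nonnegativity is known,
    so that \<open>bdd\<close> confines \<open>y\<close> to a compact interval. \<open>z\<close> and
    \<open>v\<close> below use the times \<open>t n\<close> and \<open>\<tau> n\<close>
    instead.\<close>
  define y where "y n = X n / sqrt (t n + 1)" for n
  have y0: "0 \<le> \<phi> (y n)" for n
    using pos[of n] t0[of n] by (simp add: w_def selfsim_def zero_le_mult_iff y_def X_def)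
  have "y n \<in> {-R..R}" for n using bdd[OF y0[of n]] by auto
  then obtain l r where r: "strict_mono r" and lim: "(y \<circ> r) \<longlonglongrightarrow> l"
    using compact_Icc[of "-R" R] unfolding compact_def by metis
  \<comment> \<open>The unit lattice step after rescaling.\<close>
  define k where "k n = 1 / sqrt (t n)" for n
  define z where "z n = X n / sqrt (t n)" for n
  have k0: "0 < k n" for n using t0[of n] by (simp add: k_def)
  have "\<forall>n. \<exists>\<xi> \<eta>. \<bar>\<xi> - z n\<bar> \<le> k n \<and> \<bar>\<eta> - z n\<bar> \<le> k n \<and>
      \<phi> (z n + k n) + \<phi> (z n - k n) - 2 * \<phi> (z n) = (k n)\<^sup>2 * (\<phi>'' \<xi> + \<phi>'' \<eta>) / 2"
    using second_difference[OF f f' k0] by blast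
  then obtain \<xi> \<eta> where xi: "\<And>n. \<bar>\<xi> n - z n\<bar> \<le> k n" and eta: "\<And>n. \<bar>\<eta> n - z n\<bar> \<le> k n"
    and second: "\<And>n. \<phi> (z n + k n) + \<phi> (z n - k n) - 2 * \<phi> (z n) = (k n)\<^sup>2 * (\<phi>'' (\<xi> n) + \<phi>'' (\<eta> n)) / 2"
    by metis
  have "\<forall>n. \<exists>\<tau>. t n < \<tau> \<and> \<tau> < t n + 1 \<and> selfsim \<sigma> \<phi> (t n + 1) (X n) - selfsim \<sigma> \<phi> (t n) (X n)
     = - (\<tau> powr (- \<sigma> - 1)) * (\<sigma> * \<phi> (X n / sqrt \<tau>) + X n / sqrt \<tau> * \<phi>' (X n / sqrt \<tau>) / 2)"
    using selfsim_time_increment[OF f t0(1)] by blast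
  then obtain \<tau> where tau: "\<And>n. t n < \<tau> n" "\<And>n. \<tau> n < t n + 1"
    and incr: "\<And>n. selfsim \<sigma> \<phi> (t n + 1) (X n) - selfsim \<sigma> \<phi> (t n) (X n)
     = - (\<tau> n powr (- \<sigma> - 1)) * (\<sigma> * \<phi> (X n / sqrt (\<tau> n)) + X n / sqrt (\<tau> n) * \<phi>' (X n / sqrt (\<tau> n)) / 2)"
    by metis
  define v where "v n = X n / sqrt (\<tau> n)" for n
  define m where "m n = (\<phi>'' (\<xi> n) + \<phi>'' (\<eta> n)) / 2" for n
  \<comment> \<open>The square of \<open>k n\<close> is \<open>1 / t n\<close>, which lowers the
    power by one. Holding multiplies the increment by \<open>1 - q\<close>, whence the two branches
    of \<open>D\<close>.\<close>
  have bell: "bellman q (w (t n)) (x n) - w (t n) (x n) = t n powr (- \<sigma> - 1) / 2 * D (m n)" for n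
  proof -
    have "avg (w (t n)) (x n) - w (t n) (x n) = t n powr (- \<sigma>) * (\<phi> (z n + k n) + \<phi> (z n - k n) - 2 * \<phi> (z n)) / 2"
      by (simp add: avg_def w_def selfsim_def z_def k_def X_def add_divide_distrib diff_divide_distrib algebra_simps)
    also have "\<dots> = t n powr (- \<sigma> - 1) / 2 * m n"
      unfolding second m_def using t0[of n] by (simp add: k_def power_divide powr_diff)
    finally have a: "avg (w (t n)) (x n) = w (t n) (x n) + t n powr (- \<sigma> - 1) / 2 * m n" by simp
    have "t n powr (- \<sigma> - 1) / 2 * D (m n) = max (t n powr (- \<sigma> - 1) / 2 * m n) (t n powr (- \<sigma> - 1) / 2 * ((1 - q) * m n))"
      unfolding D_def by (rule max_mult_distrib_left[THEN trans]) simp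
    then show ?thesis unfolding bellman_def a by (simp add: max_def algebra_simps)
  qed
  \<comment> \<open>The violation divided by \<open>t n powr (- \<sigma> - 1) / 2\<close>.\<close>
  have ineq: "D (m n) + (\<tau> n / t n) powr (- \<sigma> - 1) * (2 * \<sigma> * \<phi> (v n) + v n * \<phi>' (v n)) \<le> 0" for n
  proof -
    have "t n powr (- \<sigma> - 1) / 2 * D (m n) \<le> - (\<tau> n powr (- \<sigma> - 1)) * (\<sigma> * \<phi> (v n) + v n * \<phi>' (v n) / 2)"
      using viol[of n] incr[of n] bell[of n] unfolding v_def[symmetric] by (simp add: w_def X_def)
    moreover have "\<tau> n powr (- \<sigma> - 1) = t n powr (- \<sigma> - 1) * (\<tau> n / t n) powr (- \<sigma> - 1)"
      using t0[of n] tau(1)[of n] by (subst powr_mult[symmetric]) auto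
    ultimately have "t n powr (- \<sigma> - 1) * (D (m n) + (\<tau> n / t n) powr (- \<sigma> - 1) * (2 * \<sigma> * \<phi> (v n) + v n * \<phi>' (v n))) \<le> 0"
      by (simp add: algebra_simps)
    then show ?thesis using t0[of n] by (simp add: mult_le_0_iff)
  qed
  \<comment> \<open>The times \<open>t\<close>, \<open>\<tau>\<close> and \<open>t + 1\<close> are
    asymptotically equal and \<open>k\<close> tends to 0, so all rescaled points share the limit
    \<open>l\<close> along the subsequence.\<close>
  have t_inf: "filterlim (\<lambda>n. t (r n)) at_top sequentially"
  proof (rule filterlim_compose[of t])
    have "filterlim (\<lambda>n. real n + 1) at_top sequentially" by real_asymp
    then show "filterlim t at_top sequentially"
      by (rule filterlim_at_top_mono) (use t in auto)
  qed (rule filterlim_subseq[OF r])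
  have inv: "(\<lambda>n. 1 / t (r n)) \<longlonglongrightarrow> 0"
    using tendsto_divide_0[OF tendsto_const filterlim_at_top_imp_at_infinity[OF t_inf]] by simp
  have k_lim: "(\<lambda>n. k (r n)) \<longlonglongrightarrow> 0"
    using tendsto_real_sqrt[OF inv] by (simp add: k_def real_sqrt_divide)
  have ratio: "(\<lambda>n. \<tau> (r n) / t (r n)) \<longlonglongrightarrow> 1"
  proof (rule tendsto_sandwich[OF _ _ tendsto_const])
    show "(\<lambda>n. 1 + 1 / t (r n)) \<longlonglongrightarrow> 1" using tendsto_add[OF tendsto_const inv] by simp
    show "\<forall>\<^sub>F n in sequentially. 1 \<le> \<tau> (r n) / t (r n)"
      using t0 tau(1) by (auto simp: le_divide_eq intro!: always_eventually less_imp_le)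
    have "\<tau> n / t n \<le> 1 + 1 / t n" for n
      using t0[of n] tau(2)[of n] by (simp add: field_simps)
    then show "\<forall>\<^sub>F n in sequentially. \<tau> (r n) / t (r n) \<le> 1 + 1 / t (r n)" by simp
  qed
  have z_lim: "(\<lambda>n. z (r n)) \<longlonglongrightarrow> l"
  proof -
    have "(\<lambda>n. y (r n) * sqrt (1 + 1 / t (r n))) \<longlonglongrightarrow> l * sqrt (1 + 0)"
      using lim by (intro tendsto_intros inv) (simp add: o_def)
    moreover have "z n = y n * sqrt (1 + 1 / t n)" for n
    proof -
      have "1 + 1 / t n = (t n + 1) / t n" using t0[of n] by (simp add: field_simps)
      then show ?thesis using t0[of n] by (simp add: z_def y_def real_sqrt_divide)
    qed
    ultimately show ?thesis by simp
  qed
  have v_lim: "(\<lambda>n. v (r n)) \<longlonglongrightarrow> l"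
  proof -
    have "(\<lambda>n. z (r n) / sqrt (\<tau> (r n) / t (r n))) \<longlonglongrightarrow> l / sqrt 1"
      by (intro tendsto_intros z_lim ratio) simp
    moreover have "v n = z n / sqrt (\<tau> n / t n)" for n
      using t0[of n] tau(1)[of n] by (simp add: z_def v_def real_sqrt_divide)
    ultimately show ?thesis by simp
  qed
  have near: "(\<lambda>n. \<zeta> (r n)) \<longlonglongrightarrow> l" if "\<And>n. \<bar>\<zeta> n - z n\<bar> \<le> k n" for \<zeta>
  proof -
    have "(\<lambda>n. \<zeta> (r n) - z (r n)) \<longlonglongrightarrow> 0"
      by (rule tendsto_rabs_zero_cancel, rule tendsto_sandwich[OF _ _ tendsto_const k_lim]) (use that in auto)
    from tendsto_add[OF this z_lim] show ?thesis by simp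
  qed
  have c: "isCont \<phi>'' l" "isCont \<phi>' l" "isCont \<phi> l"
    using cont f f' by (auto simp: continuous_on_eq_continuous_at intro: DERIV_isCont)
  \<comment> \<open>In the limit a weak inequality survives at \<open>l\<close>, where
    \<open>\<phi>\<close> is nonnegative by continuity; \<open>strict\<close> at \<open>l\<close>
    forbids it.\<close>
  have "(\<lambda>n. D (m (r n)) + (\<tau> (r n) / t (r n)) powr (- \<sigma> - 1) * (2 * \<sigma> * \<phi> (v (r n)) + v (r n) * \<phi>' (v (r n))))
     \<longlonglongrightarrow> D ((\<phi>'' l + \<phi>'' l) / 2) + 1 powr (- \<sigma> - 1) * (2 * \<sigma> * \<phi> l + l * \<phi>' l)"
    unfolding D_def m_def
    by (intro tendsto_intros tendsto_max ratio v_lim isCont_tendsto_compose[OF c(1)] isCont_tendsto_compose[OF c(2)]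
        isCont_tendsto_compose[OF c(3)] near xi eta) simp_all
  then have "D ((\<phi>'' l + \<phi>'' l) / 2) + 1 powr (- \<sigma> - 1) * (2 * \<sigma> * \<phi> l + l * \<phi>' l) \<le> 0"
    by (rule LIMSEQ_le_const2) (use ineq in auto)
  moreover have "0 \<le> \<phi> l"
    by (rule LIMSEQ_le_const[OF isCont_tendsto_compose[OF c(3) lim[unfolded o_def]]]) (use y0 in auto)
  ultimately show False using strict[of l] by (simp add: D_def)
qed

section \<open>From a profile to a lower bound on the value function\<close>

text \<open>At time \<open>a\<close> the positive part of the subsolution has bounded support, and
  after \<open>N\<close> steps the value function is positive there, so a small multiple fits below
  it. Monotonicity of \<open>bellman\<close> preserves this order at all later times.\<close>

lemma opt_val_lower:
  fixes \<phi> \<phi>' \<phi>'' :: "real \<Rightarrow> real"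
  assumes q: "0 < q" "q < 1" and \<sigma>: "0 \<le> \<sigma>"
    and f: "\<And>y. (\<phi> has_real_derivative \<phi>' y) (at y)"
    and f': "\<And>y. (\<phi>' has_real_derivative \<phi>'' y) (at y)"
    and cont: "continuous_on UNIV \<phi>''"
    and bdd: "\<And>y. 0 \<le> \<phi> y \<Longrightarrow> \<bar>y\<bar> \<le> R"
    and strict: "\<And>y. 0 \<le> \<phi> y \<Longrightarrow> 0 < max (\<phi>'' y) ((1 - q) * \<phi>'' y) + y * \<phi>' y + 2 * \<sigma> * \<phi> y"
    and top: "0 < \<phi> 0"
  shows "\<exists>c>0. \<forall>n\<ge>1. c * real n powr (- \<sigma>) < opt_val q n 0"
proof -
  let ?w = "\<lambda>t x. selfsim \<sigma> \<phi> t (real_of_int x)"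
  obtain a where a: "1 \<le> a" and sub: "\<And>t x. a \<le> t \<Longrightarrow> 0 \<le> ?w (t + 1) x \<Longrightarrow> ?w (t + 1) x \<le> bellman q (?w t) x"
    using discrete_subsolution[OF f f' cont bdd strict] by blast
  define N where "N = nat \<lceil>\<bar>R\<bar> * sqrt a\<rceil>"
  have supp: "\<bar>x\<bar> \<le> int N" if "0 < ?w a x" for x
  proof -
    have "0 \<le> \<phi> (real_of_int x / sqrt a)" using that a by (simp add: selfsim_def zero_less_mult_iff)
    then have "\<bar>real_of_int x / sqrt a\<bar> \<le> R" by (rule bdd)
    then have "\<bar>real_of_int x\<bar> \<le> R * sqrt a" using a by (simp add: abs_divide divide_le_eq)
    also have "\<dots> \<le> \<bar>R\<bar> * sqrt a" using a by (intro mult_right_mono) auto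
    finally show ?thesis unfolding N_def by linarith
  qed
  let ?V = "\<lambda>n. opt_val q n"
  have "\<exists>c>0. \<forall>x\<in>{-int N..int N}. c * ?w a x \<le> ?V N x"
  proof -
    \<comment> \<open>The summand 1 keeps the divisor \<open>B\<close> positive.\<close>
    define B where "B = 1 + (\<Sum>x\<in>{-int N..int N}. \<bar>?w a x\<bar>)"
    have B: "1 \<le> B" unfolding B_def by (simp add: sum_nonneg)
    have le_B: "?w a x \<le> B" if "x \<in> {-int N..int N}" for x
      using member_le_sum[OF that, of "\<lambda>x. \<bar>?w a x\<bar>"] unfolding B_def by auto
    define b where "b = Min (?V N ` {-int N..int N})"
    have "0 < b" unfolding b_def using opt_val_pos[OF q] by (subst Min_gr_iff) auto
    moreover have "b / B * ?w a x \<le> ?V N x" if "x \<in> {-int N..int N}" for x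
    proof -
      have "b / B * ?w a x \<le> b / B * B" using le_B[OF that] B \<open>0 < b\<close> by (intro mult_left_mono) auto
      also have "\<dots> = b" using B by simp
      also have "b \<le> ?V N x" unfolding b_def using that by (intro Min_le) auto
      finally show ?thesis .
    qed
    ultimately show ?thesis using B by (intro exI[of _ "b / B"]) auto
  qed
  then obtain c where c: "0 < c" and start: "\<And>x. x \<in> {-int N..int N} \<Longrightarrow> c * ?w a x \<le> ?V N x" by blast
  have nn: "0 \<le> ?V n x" for n x using opt_val_bounds[of q n x] q by simp
  \<comment> \<open>The subsolution inequality is available only where the profile is nonnegative;
    taking the positive part covers the other sites, where the bound is 0.\<close>
  have iter: "c * max 0 (?w (a + real j) x) \<le> ?V (N + j) x" for j x
  proof (induction j arbitrary: x)
    case 0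
    show ?case
      using supp[of x] start[of x] nn[of N x] by (cases "0 < ?w a x") (auto simp: max_def abs_le_iff)
  next
    case (Suc j)
    let ?u = "\<lambda>x. max 0 (?w (a + real j) x)"
    have "max 0 (?w (a + real j + 1) x) \<le> bellman q ?u x"
    proof -
      have "0 \<le> bellman q ?u x" using q by (intro bellman_nonneg) auto
      moreover have "?w (a + real j + 1) x \<le> bellman q ?u x" if "0 \<le> ?w (a + real j + 1) x"
      proof -
        have "?w (a + real j + 1) x \<le> bellman q (?w (a + real j)) x" using that by (intro sub) auto
        also have "\<dots> \<le> bellman q ?u x" using q by (intro bellman_mono) auto
        finally show ?thesis .
      qed
      ultimately show ?thesis by (auto simp: max_def)
    qed
    then have "c * max 0 (?w (a + real j + 1) x) \<le> bellman q (\<lambda>x. c * ?u x) x"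
      using c by (simp add: bellman_scale)
    also have "\<dots> \<le> bellman q (?V (N + j)) x" using q Suc by (intro bellman_mono) auto
    finally show ?case by (simp add: add_ac)
  qed
  \<comment> \<open>One constant for all \<open>n\<close>: the finitely many values handle
    \<open>n \<le> N\<close>, and the inserted entry handles larger \<open>n\<close> through
    \<open>a + (n - N) \<le> (a + 1) * n\<close>.\<close>
  define b where "b = Min (insert (c * \<phi> 0 * (a + 1) powr (- \<sigma>)) ((\<lambda>n. ?V n 0) ` {..N}))"
  have b: "0 < b" unfolding b_def using opt_val_pos[OF q, of 0] c top a by (subst Min_gr_iff) auto
  have "b * real n powr (- \<sigma>) \<le> ?V n 0" if n: "1 \<le> n" for n
  proof (cases "n \<le> N")
    case True
    have "b * real n powr (- \<sigma>) \<le> b * 1"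
      using b n \<sigma> powr_mono[of "- \<sigma>" 0 "real n"] by (intro mult_left_mono) auto
    also have "\<dots> \<le> ?V n 0" unfolding mult_1_right b_def using True by (intro Min_le) auto
    finally show ?thesis .
  next
    case False
    have "b * real n powr (- \<sigma>) \<le> (c * \<phi> 0 * (a + 1) powr (- \<sigma>)) * real n powr (- \<sigma>)"
      unfolding b_def by (intro mult_right_mono Min_le) auto
    also have "\<dots> = c * \<phi> 0 * ((a + 1) * real n) powr (- \<sigma>)"
      using a n by (simp add: powr_mult)
    also have "\<dots> \<le> c * \<phi> 0 * (a + real (n - N)) powr (- \<sigma>)"
    proof -
      have "a + real (n - N) \<le> a * real n + real n"
        using a n mult_left_mono[of 1 "real n" a] by (intro add_mono) auto
      then show ?thesis using c top a \<sigma> by (intro mult_left_mono powr_mono2') (auto simp: algebra_simps)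
    qed
    also have "\<dots> = c * max 0 (?w (a + real (n - N)) 0)"
      using top by (simp add: selfsim_def)
    also have "\<dots> \<le> ?V n 0" using iter[of "n - N" 0] False by simp
    finally show ?thesis .
  qed
  \<comment> \<open>Halving \<open>b\<close> turns the weak inequality into a strict one.\<close>
  then have "\<forall>n\<ge>1. b / 2 * real n powr (- \<sigma>) < ?V n 0"
    using b by (smt (verit) field_sum_of_halves mult_strict_right_mono of_nat_0_less_iff powr_gt_zero zero_less_one_class.zero_less_one less_le_trans le_numeral_extra(3) not_less_iff_gr_or_eq)
  then show ?thesis using b by (intro exI[of _ "b / 2"]) auto
qed

section \<open>The two profiles\<close>

text \<open>The factor \<open>h\<close> gives a gain away from the origin at the price of a deficit
  near it, and the deficit is repaid by holding on the concave peak of the profile.\<close>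

lemma opt_val_lower_near_half:
  assumes q: "0 < q" "q < 1"
  shows "\<exists>c>0. \<forall>n\<ge>1. c * real n powr (- (1 / 2 - q / 100)) < opt_val q n 0"
proof -
  define e where "e = q / 10"
  have e: "0 < e" "e < 1 / 10" using q by (auto simp: e_def)
  define G where "G y = exp (- y\<^sup>2 / 2)" for y :: real
  define h where "h y = 1 - e * ln (1 + y\<^sup>2)" for y
  define h' where "h' y = - 2 * e * y / (1 + y\<^sup>2)" for y
  define h'' where "h'' y = 2 * e * (y\<^sup>2 - 1) / (1 + y\<^sup>2)\<^sup>2" for y
  have p: "0 < 1 + y\<^sup>2" "1 + y\<^sup>2 \<noteq> 0" for y :: real using zero_le_power2[of y] by linarith+
  have G0: "0 < G y" for y by (simp add: G_def)
  have dG: "(G has_real_derivative - y * G y) (at y)" for y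
    unfolding G_def by (auto intro!: derivative_eq_intros)
  have dh: "(h has_real_derivative h' y) (at y)" for y
    unfolding h_def h'_def using p[of y] by (auto intro!: derivative_eq_intros simp: field_simps)
  have dh': "(h' has_real_derivative h'' y) (at y)" for y
    unfolding h'_def h''_def using p[of y] by (auto intro!: derivative_eq_intros simp: field_simps power2_eq_square)
       (simp only: minus_divide_left minus_diff_eq)
  define \<phi> where "\<phi> y = G y * h y" for y
  define \<phi>' where "\<phi>' y = G y * (h' y - y * h y)" for y
  define \<phi>'' where "\<phi>'' y = G y * (h'' y - 2 * y * h' y + (y\<^sup>2 - 1) * h y)" for y
  show ?thesis
  proof (rule opt_val_lower[OF q])
    show "0 \<le> 1 / 2 - q / 100" using q by simp
    show "(\<phi> has_real_derivative \<phi>' y) (at y)" for y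
      unfolding \<phi>_def \<phi>'_def
      by (rule DERIV_cong[OF DERIV_mult[OF dG dh]]) (simp add: algebra_simps)
    show "(\<phi>' has_real_derivative \<phi>'' y) (at y)" for y
      unfolding \<phi>'_def \<phi>''_def
      by (rule DERIV_cong[OF DERIV_mult[OF dG DERIV_diff[OF dh' DERIV_mult[OF DERIV_ident dh]]]])
         (simp add: algebra_simps power2_eq_square)
    show "continuous_on UNIV \<phi>''"
      unfolding \<phi>''_def G_def h_def h'_def h''_def using p by (intro continuous_intros) auto
    show "0 < \<phi> 0" by (simp add: \<phi>_def G_def h_def)
  next
    fix y assume "0 \<le> \<phi> y"
    then have "e * ln (1 + y\<^sup>2) \<le> 1" using G0[of y] by (simp add: \<phi>_def zero_le_mult_iff h_def)
    then have "ln (1 + y\<^sup>2) \<le> 1 / e" using e by (simp add: field_simps)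
    then have "1 + y\<^sup>2 \<le> exp (1 / e)" using p[of y] by (metis exp_le_cancel_iff exp_ln)
    then have "y\<^sup>2 \<le> exp (1 / e)" by simp
    then show "\<bar>y\<bar> \<le> sqrt (exp (1 / e))" by (simp add: real_le_rsqrt)
  next
    fix y assume "0 \<le> \<phi> y"
    then have h0: "0 \<le> h y" using G0[of y] by (simp add: \<phi>_def zero_le_mult_iff)
    have h1: "h y \<le> 1" using e by (simp add: h_def)
    have g: "h'' y - y * h' y = e * (2 - 4 / (1 + y\<^sup>2)\<^sup>2)"
      unfolding h'_def h''_def using p[of y] by (simp add: divide_simps) (simp add: power2_eq_square algebra_simps)
    \<comment> \<open>The Gaussian solves the equation with exponent 1/2 exactly, so only the
      derivatives of \<open>h\<close> and twice the exponent gap, \<open>q / 50\<close>,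
      remain.\<close>
    have id: "\<phi>'' y + y * \<phi>' y + 2 * (1 / 2 - q / 100) * \<phi> y = G y * (h'' y - y * h' y - q / 50 * h y)"
      by (simp add: \<phi>_def \<phi>'_def \<phi>''_def power2_eq_square algebra_simps)
    have qh: "q / 50 * h y \<le> q / 50" using h1 q by simp
    show "0 < max (\<phi>'' y) ((1 - q) * \<phi>'' y) + y * \<phi>' y + 2 * (1 / 2 - q / 100) * \<phi> y"
    proof (cases "1 / 2 \<le> y\<^sup>2")
      \<comment> \<open>Without holding: the gain \<open>e * (2 / 9) = q / 45\<close> exceeds
        \<open>q / 50\<close>.\<close>
      case True
      have "(3 / 2)\<^sup>2 \<le> (1 + y\<^sup>2)\<^sup>2" using True by (intro power_mono) auto
      then have "4 / (1 + y\<^sup>2)\<^sup>2 \<le> 4 / (3 / 2)\<^sup>2" by (intro divide_left_mono) auto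
      then have "2 / 9 \<le> 2 - 4 / (1 + y\<^sup>2)\<^sup>2" by (simp add: power2_eq_square)
      then have "e * (2 / 9) \<le> h'' y - y * h' y" unfolding g using e by (intro mult_left_mono) auto
      then have "q / 45 \<le> h'' y - y * h' y" by (simp add: e_def)
      then have "0 < h'' y - y * h' y - q / 50 * h y" using qh q by linarith
      then have "0 < \<phi>'' y + y * \<phi>' y + 2 * (1 / 2 - q / 100) * \<phi> y" unfolding id using G0[of y] by simp
      then show ?thesis by (simp add: max_def)
    next
      \<comment> \<open>With holding: \<open>\<phi>''\<close> is at most \<open>- G y / 4\<close>,
        so holding gains at least \<open>q / 4\<close> (in units of \<open>G y\<close>) against a
        loss of at most \<open>2 * e + q / 50 = q / 5 + q / 50\<close>.\<close>
      case False
      then have y: "y\<^sup>2 < 1 / 2" by simp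
      have "4 / (1 + y\<^sup>2)\<^sup>2 \<le> 4" using p[of y] by (simp add: divide_le_eq)
      then have "- 2 * e \<le> h'' y - y * h' y" unfolding g using e mult_left_mono[of "-2" "2 - 4 / (1 + y\<^sup>2)\<^sup>2" e] by simp
      moreover have "h'' y - 2 * y * h' y + (y\<^sup>2 - 1) * h y \<le> - 1 / 4"
      proof -
        have "h'' y \<le> 0" unfolding h''_def using e y p[of y] by (intro divide_nonpos_pos mult_nonneg_nonpos) auto
        moreover have "- 2 * y * h' y \<le> 4 * e * y\<^sup>2"
          using p[of y] e mult_left_mono[of 1 "1 + y\<^sup>2" "4 * e * y\<^sup>2"]
          by (simp add: h'_def divide_le_eq power2_eq_square algebra_simps)
        moreover have "4 * e * y\<^sup>2 \<le> 4 * e * (1 / 2)" using y e by (intro mult_left_mono) auto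
        moreover have "1 - e / 2 \<le> h y"
        proof -
          have "ln (1 + y\<^sup>2) \<le> 1 / 2" using ln_add_one_self_le_self[of "y\<^sup>2"] y by simp
          then show ?thesis using e mult_left_mono[of "ln (1 + y\<^sup>2)" "1 / 2" e] by (simp add: h_def)
        qed
        moreover have "(y\<^sup>2 - 1) * h y \<le> (- 1 / 2) * h y" using y h0 by (intro mult_right_mono) auto
        ultimately show ?thesis using e by linarith
      qed
      then have "q * (h'' y - 2 * y * h' y + (y\<^sup>2 - 1) * h y) \<le> q * (- 1 / 4)" using q by (intro mult_left_mono) auto
      ultimately have "0 < (h'' y - y * h' y - q / 50 * h y) - q * (h'' y - 2 * y * h' y + (y\<^sup>2 - 1) * h y)"
        using qh q unfolding e_def by linarith
      then have "0 < G y * ((h'' y - y * h' y - q / 50 * h y) - q * (h'' y - 2 * y * h' y + (y\<^sup>2 - 1) * h y))"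
        using G0[of y] by simp
      also have "\<dots> = (1 - q) * \<phi>'' y + y * \<phi>' y + 2 * (1 / 2 - q / 100) * \<phi> y"
        using id unfolding \<phi>''_def by (simp add: algebra_simps)
      finally show ?thesis by (simp add: max_def)
    qed
  qed
qed

text \<open>The peak has width of order sqrt(1 - q). Outside it the inequality holds without
  holding; inside, the lazy diffusion and drift terms lose only a bounded amount, which the height
  of the peak repays even for a small exponent. The threshold \<open>exp (- 6)\<close> corresponds
  to the exponent 1/2.\<close>

lemma opt_val_lower_log:
  assumes q: "q < 1" "6 * (1 - q) < exp (- 6)"
  shows "\<exists>c>0. \<forall>n\<ge>1. c * real n powr (- (3 / - ln (6 * (1 - q)))) < opt_val q n 0"
proof -
  define d where "d = 1 - q"
  have d: "0 < d" "6 * d < exp (- 6)" using q by (auto simp: d_def)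
  have e6: "exp (- 6) < (1 :: real)" by simp
  have d6: "6 * d < 1" using order.strict_trans[OF d(2) e6] .
  then have q0: "0 < q" by (simp add: d_def)
  have "ln (6 * d) < - 6" using d by (metis ln_exp ln_less_cancel_iff exp_gt_zero mult_pos_pos zero_less_numeral)
  then have L: "6 < - ln (6 * d)" by simp
  \<comment> \<open>On the peak \<open>y\<^sup>2 \<le> 2 * d\<close> the profile is at least
    \<open>- ln (6 * d)\<close>, so this \<open>s\<close> makes \<open>s * \<phi> y\<close> at least
    3.\<close>
  define s where "s = 3 / - ln (6 * d)"
  have s: "0 < s" "s * - ln (6 * d) = 3" using L by (auto simp: s_def)
  have p: "0 < d + y\<^sup>2" "d + y\<^sup>2 \<noteq> 0" for y using zero_le_power2[of y] d by linarith+
  \<comment> \<open>The factor 2 makes \<open>0 \<le> \<phi> y\<close> equivalent to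
    \<open>d + y\<^sup>2 \<le> 1 / 2\<close>.\<close>
  define \<phi> where "\<phi> y = - ln (2 * (d + y\<^sup>2))" for y
  define \<phi>' where "\<phi>' y = - 2 * y / (d + y\<^sup>2)" for y
  define \<phi>'' where "\<phi>'' y = 2 * (y\<^sup>2 - d) / (d + y\<^sup>2)\<^sup>2" for y
  have "\<exists>c>0. \<forall>n\<ge>1. c * real n powr (- s) < opt_val q n 0"
  proof (rule opt_val_lower[OF q0 q(1)])
    show "0 \<le> s" using s by simp
    show "(\<phi> has_real_derivative \<phi>' y) (at y)" for y
      unfolding \<phi>_def \<phi>'_def using p[of y] by (auto intro!: derivative_eq_intros simp: field_simps)
    show "(\<phi>' has_real_derivative \<phi>'' y) (at y)" for y
      unfolding \<phi>'_def \<phi>''_def using p[of y] by (auto intro!: derivative_eq_intros simp: field_simps power2_eq_square)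
       (simp only: minus_divide_left minus_diff_eq)
    show "continuous_on UNIV \<phi>''"
      unfolding \<phi>''_def using p by (intro continuous_intros) auto
    show "0 < \<phi> 0" using d(1) d6 by (simp add: \<phi>_def ln_less_zero)
  next
    fix y assume "0 \<le> \<phi> y"
    then have le: "d + y\<^sup>2 \<le> 1 / 2" using p[of y] by (simp add: \<phi>_def)
    then have "y\<^sup>2 \<le> 1" using d by simp
    then show "\<bar>y\<bar> \<le> 1" by (simp add: abs_square_le_1)
  next
    fix y assume phi: "0 \<le> \<phi> y"
    then have le: "d + y\<^sup>2 \<le> 1 / 2" using p[of y] by (simp add: \<phi>_def)
    show "0 < max (\<phi>'' y) ((1 - q) * \<phi>'' y) + y * \<phi>' y + 2 * s * \<phi> y"
    proof (cases "2 * d < y\<^sup>2")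
      case True
      \<comment> \<open>Over the common denominator, \<open>d + y\<^sup>2 \<le> 1 / 2\<close> leaves
        a numerator of at least \<open>y\<^sup>2 - 2 * d\<close>, which is positive off the
        peak.\<close>
      have "y * \<phi>' y = - 2 * y\<^sup>2 * (d + y\<^sup>2) / (d + y\<^sup>2)\<^sup>2"
        using p[of y] by (simp add: \<phi>'_def power2_eq_square)
      then have "\<phi>'' y + y * \<phi>' y = 2 * (y\<^sup>2 - d - y\<^sup>2 * (d + y\<^sup>2)) / (d + y\<^sup>2)\<^sup>2"
        unfolding \<phi>''_def by (simp add: add_divide_distrib[symmetric] algebra_simps)
      moreover have "y\<^sup>2 * (d + y\<^sup>2) \<le> y\<^sup>2 * (1 / 2)" using le by (intro mult_left_mono) auto
      ultimately have "0 < \<phi>'' y + y * \<phi>' y" using True p[of y] by simp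
      moreover have "0 \<le> s * \<phi> y" using s phi by simp
      ultimately show ?thesis by (simp add: max_def)
    next
      case False
      \<comment> \<open>On the peak diffusion and drift lose at most 2 each, while the term
        \<open>2 * s * \<phi> y\<close> contributes at least 6.\<close>
      have "d * \<phi>'' y \<ge> - 2"
      proof -
        have "d * d \<le> (d + y\<^sup>2)\<^sup>2" using d by (simp add: power2_eq_square mult_mono)
        moreover have "0 \<le> d * y\<^sup>2" using d by simp
        ultimately have "- 2 * (d + y\<^sup>2)\<^sup>2 \<le> d * (2 * (y\<^sup>2 - d))" by (simp add: algebra_simps)
        then show ?thesis using p[of y] unfolding \<phi>''_def by (simp add: le_divide_eq)
      qed
      moreover have "- 2 \<le> y * \<phi>' y"
        using p[of y] d unfolding \<phi>'_def by (simp add: le_divide_eq divide_le_eq power2_eq_square)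
      moreover have "3 \<le> s * \<phi> y"
      proof -
        have "ln (2 * (d + y\<^sup>2)) \<le> ln (6 * d)" using False p[of y] d by (subst ln_le_cancel_iff) auto
        then have "s * - ln (6 * d) \<le> s * \<phi> y" using s unfolding \<phi>_def by (intro mult_left_mono) auto
        then show ?thesis using s by simp
      qed
      ultimately show ?thesis by (simp add: d_def[symmetric] max_def)
    qed
  qed
  then show ?thesis by (simp add: s_def d_def)
qed

section \<open>Choice of the exponents\<close>

theorem theorem2:
  "\<exists>\<sigma>\<^sub>p \<sigma>\<^sub>m :: real \<Rightarrow> real.
     (\<forall>q\<in>{0<..<1}. \<sigma>\<^sub>p q \<in> {0<..<1/2} \<and> \<sigma>\<^sub>m q \<in> {0<..<1/2}) \<and>
     (\<forall>q\<in>{0<..<1}. \<exists>c>0. \<exists>C>0. \<forall>n::nat. 1 \<le> n \<longrightarrow>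
        c * real n powr (- \<sigma>\<^sub>m q) < sup_return_prob q n \<and>
        sup_return_prob q n < C * real n powr (- \<sigma>\<^sub>p q)) \<and>
     (\<sigma>\<^sub>m \<longlongrightarrow> 0) (at_left 1)"
proof -
  define \<sigma>\<^sub>p where "\<sigma>\<^sub>p q = (1 - q) / 8" for q :: real
  \<comment> \<open>The logarithmic profile serves \<open>q\<close> near 1, the perturbed Gaussian
    all other \<open>q\<close>. At the switch \<open>6 * (1 - q) = exp (- 6)\<close> the first
    expression reaches 1/2, so it is below 1/2 where it is used.\<close>
  define \<sigma>\<^sub>m where "\<sigma>\<^sub>m q = (if 6 * (1 - q) < exp (- 6) then 3 / - ln (6 * (1 - q)) else 1 / 2 - q / 100)"
    for q :: real
  have "\<sigma>\<^sub>m q \<in> {0<..<1/2}" if q: "q \<in> {0<..<1}" for q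
  proof (cases "6 * (1 - q) < exp (- 6)")
    case True
    then have "ln (6 * (1 - q)) < ln (exp (- 6))" using q by (subst ln_less_cancel_iff) auto
    then have "6 < - ln (6 * (1 - q))" by simp
    then have "3 / - ln (6 * (1 - q)) < 3 / 6" "0 < 3 / - ln (6 * (1 - q))"
      by (intro divide_strict_left_mono divide_pos_pos; simp)+
    then show ?thesis using True by (simp add: \<sigma>\<^sub>m_def)
  next
    case False
    have "0 < 1 / 2 - q / 100" "1 / 2 - q / 100 < 1 / 2" using q by auto
    then show ?thesis using False by (simp only: \<sigma>\<^sub>m_def if_False greaterThanLessThan_iff)
  qed
  then have range: "\<forall>q\<in>{0<..<1}. \<sigma>\<^sub>p q \<in> {0<..<1/2} \<and> \<sigma>\<^sub>m q \<in> {0<..<1/2}"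
    by (auto simp: \<sigma>\<^sub>p_def)
  have bounds: "\<exists>c>0. \<exists>C>0. \<forall>n::nat. 1 \<le> n \<longrightarrow> c * real n powr (- \<sigma>\<^sub>m q) < sup_return_prob q n \<and>
      sup_return_prob q n < C * real n powr (- \<sigma>\<^sub>p q)" if q: "q \<in> {0<..<1}" for q
  proof -
    have "\<exists>c>0. \<forall>n\<ge>1. c * real n powr (- \<sigma>\<^sub>m q) < opt_val q n 0"
      using opt_val_lower_log[of q] opt_val_lower_near_half[of q] q by (auto simp: \<sigma>\<^sub>m_def)
    then obtain c where c: "0 < c" "\<forall>n\<ge>1. c * real n powr (- \<sigma>\<^sub>m q) < opt_val q n 0" by blast
    \<comment> \<open>The factor 2 provides the strict inequality.\<close>
    have "opt_val q n 0 < 2 * real n powr (- \<sigma>\<^sub>p q)" if n: "1 \<le> n" for n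
    proof -
      have "opt_val q n 0 \<le> real (n + 1) powr (- \<sigma>\<^sub>p q)"
        using opt_val_upper[of q n 0] q by (simp add: \<sigma>\<^sub>p_def)
      also have "\<dots> \<le> real n powr (- \<sigma>\<^sub>p q)"
        using n q by (intro powr_mono2') (auto simp: \<sigma>\<^sub>p_def)
      also have "\<dots> < 2 * real n powr (- \<sigma>\<^sub>p q)" using n by simp
      finally show ?thesis .
    qed
    then show ?thesis using c q
      by (intro exI[of _ c] conjI exI[of _ "2 :: real"]) (auto simp: sup_return_prob_eq)
  qed
  have "((\<lambda>q :: real. 3 / - ln (6 * (1 - q))) \<longlongrightarrow> 0) (at_left 1)" by real_asymp
  \<comment> \<open>Close to 1 only the logarithmic branch is in force, so the limit is decided
    there.\<close>
  moreover have "\<forall>\<^sub>F q in at_left 1. 3 / - ln (6 * (1 - q)) = \<sigma>\<^sub>m q"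
  proof -
    have "\<forall>\<^sub>F q :: real in at_left 1. 6 * (1 - q) < exp (- 6)" by real_asymp
    then show ?thesis by eventually_elim (simp add: \<sigma>\<^sub>m_def)
  qed
  ultimately have "(\<sigma>\<^sub>m \<longlongrightarrow> 0) (at_left 1)" by (rule Lim_transform_eventually)
  then show ?thesis using range bounds by (intro exI[of _ \<sigma>\<^sub>p] exI[of _ \<sigma>\<^sub>m] conjI) auto
qed

end
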